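(* Let $G$ be a ($C_4$, prism)-free perfect graph. Let $P$ be an induced paw in $G$ with vertex set $\{a,c,b_1,b_2\}$ and edge set $\{ab_1,ab_2,b_1b_2,ac\}$. Then either $a$ breaks $\{c,b_1,b_2\}$, or $b_1$ breaks $\{c,b_2\}$, or $b_2$ breaks $\{c,b_1\}$.
   Context: All graphs finite and simple. $C_4$ is the induced cycle on four vertices. A prism is two vertex-disjoint triangles $\{a_1,a_2,a_3\}$, $\{b_1,b_2,b_3\}$ with three vertex-disjoint induced paths $P_i$ from $a_i$ to $b_i$ such that for $i<j$ the only edges between $V(P_i)$ and $V(P_j)$ are $a_ia_j,b_ib_j$; ($C_4$, prism)-free means containing neither as an induced subgraph. A paw is the graph with vertices $v_1,\dots,v_4$ and edges $v_1v_2,v_2v_3,v_3v_4,v_2v_4$. For $X\subseteq V(G)$, $N[X]$ is $X$ together with all vertices having a neighbor in $X$. For $Y\subseteq V(G)$ and $x\notin Y$, $x$ breaks $Y$ if for every connected component $D$ of $G\setminus N[x]$, $Y\not\subseteq N[D]$. *)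

theory Defs
  imports Main
begin

text \<open>A finite simple graph: finite vertex set V, symmetric irreflexive adjacency E on V.\<close>
definition graph :: "'a set \<Rightarrow> ('a \<Rightarrow> 'a \<Rightarrow> bool) \<Rightarrow> bool" where
  "graph V E \<longleftrightarrow> finite V \<and> (\<forall>x y. E x y \<longrightarrow> x \<in> V \<and> y \<in> V)
      \<and> (\<forall>x y. E x y \<longrightarrow> E y x) \<and> (\<forall>x. \<not> E x x)"

text \<open>Induced C4.\<close>
definition has_induced_C4 :: "'a set \<Rightarrow> ('a \<Rightarrow> 'a \<Rightarrow> bool) \<Rightarrow> bool" where
  "has_induced_C4 V E \<longleftrightarrow> (\<exists>v1 v2 v3 v4. v1 \<in> V \<and> v2 \<in> V \<and> v3 \<in> V \<and> v4 \<in> V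
      \<and> distinct [v1, v2, v3, v4]
      \<and> E v1 v2 \<and> E v2 v3 \<and> E v3 v4 \<and> E v4 v1 \<and> \<not> E v1 v3 \<and> \<not> E v2 v4)"

text \<open>An induced path, given as the list of its vertices in order.\<close>
definition induced_path :: "'a set \<Rightarrow> ('a \<Rightarrow> 'a \<Rightarrow> bool) \<Rightarrow> 'a list \<Rightarrow> bool" where
  "induced_path V E ps \<longleftrightarrow> ps \<noteq> [] \<and> distinct ps \<and> set ps \<subseteq> V
      \<and> (\<forall>i < length ps. \<forall>j < length ps. E (ps ! i) (ps ! j) \<longleftrightarrow> (i = Suc j \<or> j = Suc i))"

definition prism_paths_ok :: "('a \<Rightarrow> 'a \<Rightarrow> bool) \<Rightarrow> 'a list \<Rightarrow> 'a list \<Rightarrow> bool" where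
  "prism_paths_ok E P Q \<longleftrightarrow> set P \<inter> set Q = {}
      \<and> (\<forall>x \<in> set P. \<forall>y \<in> set Q. E x y \<longleftrightarrow>
            ((x = hd P \<and> y = hd Q) \<or> (x = last P \<and> y = last Q)))"

text \<open>Induced prism: triangles a1a2a3 (heads) and b1b2b3 (lasts), vertex-disjoint,
  joined by three induced paths with only the triangle edges between distinct paths.\<close>
definition has_induced_prism :: "'a set \<Rightarrow> ('a \<Rightarrow> 'a \<Rightarrow> bool) \<Rightarrow> bool" where
  "has_induced_prism V E \<longleftrightarrow> (\<exists>P1 P2 P3.
      induced_path V E P1 \<and> induced_path V E P2 \<and> induced_path V E P3
      \<and> {hd P1, hd P2, hd P3} \<inter> {last P1, last P2, last P3} = {}
      \<and> E (hd P1) (hd P2) \<and> E (hd P2) (hd P3) \<and> E (hd P1) (hd P3)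
      \<and> E (last P1) (last P2) \<and> E (last P2) (last P3) \<and> E (last P1) (last P3)
      \<and> prism_paths_ok E P1 P2 \<and> prism_paths_ok E P1 P3 \<and> prism_paths_ok E P2 P3)"

definition clique :: "('a \<Rightarrow> 'a \<Rightarrow> bool) \<Rightarrow> 'a set \<Rightarrow> bool" where
  "clique E K \<longleftrightarrow> (\<forall>x \<in> K. \<forall>y \<in> K. x \<noteq> y \<longrightarrow> E x y)"

text \<open>Clique number of the induced subgraph G[S] (S finite).\<close>
definition clique_number :: "('a \<Rightarrow> 'a \<Rightarrow> bool) \<Rightarrow> 'a set \<Rightarrow> nat" where
  "clique_number E S = Max {card K | K. K \<subseteq> S \<and> clique E K}"

definition proper_colouring :: "('a \<Rightarrow> 'a \<Rightarrow> bool) \<Rightarrow> 'a set \<Rightarrow> nat \<Rightarrow> ('a \<Rightarrow> nat) \<Rightarrow> bool" where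
  "proper_colouring E S k c \<longleftrightarrow> (\<forall>x \<in> S. c x < k) \<and> (\<forall>x \<in> S. \<forall>y \<in> S. E x y \<longrightarrow> c x \<noteq> c y)"

text \<open>Chromatic number of the induced subgraph G[S].\<close>
definition chromatic_number :: "('a \<Rightarrow> 'a \<Rightarrow> bool) \<Rightarrow> 'a set \<Rightarrow> nat" where
  "chromatic_number E S = (LEAST k. \<exists>c. proper_colouring E S k c)"

definition perfect :: "'a set \<Rightarrow> ('a \<Rightarrow> 'a \<Rightarrow> bool) \<Rightarrow> bool" where
  "perfect V E \<longleftrightarrow> (\<forall>S \<subseteq> V. chromatic_number E S = clique_number E S)"

text \<open>Closed neighbourhood N[X].\<close>
definition closed_nbhd :: "'a set \<Rightarrow> ('a \<Rightarrow> 'a \<Rightarrow> bool) \<Rightarrow> 'a set \<Rightarrow> 'a set" where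
  "closed_nbhd V E X = X \<union> {v \<in> V. \<exists>x \<in> X. E v x}"

text \<open>D is a connected component of the induced subgraph G[W].\<close>
definition component :: "('a \<Rightarrow> 'a \<Rightarrow> bool) \<Rightarrow> 'a set \<Rightarrow> 'a set \<Rightarrow> bool" where
  "component E W D \<longleftrightarrow> D \<noteq> {} \<and> D \<subseteq> W
      \<and> (\<forall>u \<in> D. \<forall>v \<in> D. (u, v) \<in> {(x, y). x \<in> D \<and> y \<in> D \<and> E x y}\<^sup>*)
      \<and> (\<forall>u \<in> D. \<forall>v \<in> W - D. \<not> E u v)"

definition breaks :: "'a set \<Rightarrow> ('a \<Rightarrow> 'a \<Rightarrow> bool) \<Rightarrow> 'a \<Rightarrow> 'a set \<Rightarrow> bool" where
  "breaks V E x Y \<longleftrightarrow> x \<in> V \<and> Y \<subseteq> V \<and> x \<notin> Y \<and>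
      (\<forall>D. component E (V - closed_nbhd V E {x}) D \<longrightarrow> \<not> Y \<subseteq> closed_nbhd V E D)"

end

theory Submission
  imports Defs
begin

text \<open>Perfectness is used only through the absence of odd holes. If none of the three vertices breaks
  the corresponding set, a component of \<open>G - N[a]\<close> yields a hole \<open>H\<close> through \<open>c - a - b1\<close> on which
  \<open>b2\<close> has a neighbour besides \<open>a\<close> and \<open>b1\<close> (up to exchanging \<open>b1\<close> and \<open>b2\<close>). Choose such a hole,
  allowing \<open>c\<close> to vary over the neighbours of \<open>a\<close> with the same separation properties, with as few
  neighbours of \<open>b2\<close> as possible. If \<open>b2\<close> is attached to \<open>H\<close> not only next to \<open>b1\<close>, a path from \<open>b1\<close> to \<open>c\<close>
  avoiding \<open>N[b2]\<close> reroutes \<open>H\<close> past the first neighbour of \<open>b2\<close>, contradicting the choice. Otherwise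
  \<open>b1\<close> and \<open>b2\<close> are twins with respect to \<open>H\<close>, and paths from each of them to \<open>c\<close> avoiding the
  neighbourhood of the other close up to a forbidden configuration. Two tools recur: a triangle
  with one edge on a hole and its third vertex linked to the rest of the hole gives a prism or a
  pyramid, and a parity count along the hole for two nonadjacent vertices complete to one of its
  edges.\<close>

section \<open>Induced paths and connected sets\<close>

text \<open>Fewer neighbours of \<open>b2\<close> can be had only by leaving the hole, and the
  detour may run into neighbours of \<open>a\<close>; the new hole then starts at such a neighbour
  instead of \<open>c\<close>. This is why the induction lets \<open>c\<close> vary and keeps only
  what survives the change: \<open>hd xs\<close> is no neighbour of \<open>b2\<close>, and both
  relations \<open>linked\<close> hold at it. The triangle \<open>a b1 b2\<close> stays fixed. The
  count drops because the detour avoids \<open>N[b2]\<close>, bypasses the first neighbour of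
  \<open>b2\<close>, and returns to neighbours of \<open>b2\<close> only behind that vertex. That
  \<open>b2\<close> sees the new hole at all is a separate concern, settled by links along the old
  hole. Pyramids are excluded because two of their three paths have the same parity and close an odd
  hole. Absence of C4 enters where two nonadjacent vertices would have two nonadjacent common
  neighbours.\<close>

locale simple_graph =
  fixes E :: "'a \<Rightarrow> 'a \<Rightarrow> bool"
  assumes sym: "E x y \<Longrightarrow> E y x"
    and irrefl: "\<not> E x x"
begin

lemma sym_iff: "E x y \<longleftrightarrow> E y x"
  using sym by blast

abbreviation ipath :: "'a list \<Rightarrow> bool" where
  "ipath \<equiv> induced_path UNIV E"

lemma ipath_not_Nil: "ipath xs \<Longrightarrow> xs \<noteq> []"
  by (simp add: induced_path_def)

lemma ipath_distinct: "ipath xs \<Longrightarrow> distinct xs"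
  by (simp add: induced_path_def)

lemma ipath_nth:
  "ipath xs \<Longrightarrow> i < length xs \<Longrightarrow> j < length xs \<Longrightarrow> E (xs ! i) (xs ! j) \<longleftrightarrow> i = Suc j \<or> j = Suc i"
  by (simp add: induced_path_def)

lemma ipath_single [simp]: "ipath [x]"
  by (simp add: induced_path_def irrefl)

lemma ipath_Cons:
  assumes "xs \<noteq> []"
  shows "ipath (x # xs) \<longleftrightarrow> ipath xs \<and> x \<notin> set xs \<and> (\<forall>y\<in>set xs. E x y \<longleftrightarrow> y = hd xs)"
    (is "?L \<longleftrightarrow> ?R")
proof
  assume L: ?L
  have d: "distinct (x # xs)" using L by (rule ipath_distinct)
  have n: "E ((x # xs) ! i) ((x # xs) ! j) \<longleftrightarrow> i = Suc j \<or> j = Suc i"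
    if "i \<le> length xs" "j \<le> length xs" for i j
    using ipath_nth[OF L] that by (simp add: less_Suc_eq_le)
  have "ipath xs"
    unfolding induced_path_def
    using assms d n[of "Suc i" "Suc j" for i j] by (auto simp: Suc_le_eq)
  moreover have "E x y \<longleftrightarrow> y = hd xs" if "y \<in> set xs" for y
  proof -
    from that obtain j where j: "j < length xs" "y = xs ! j" by (auto simp: in_set_conv_nth)
    have "E x y \<longleftrightarrow> j = 0" using n[of 0 "Suc j"] j by auto
    also have "\<dots> \<longleftrightarrow> y = hd xs"
      using j d assms by (simp add: hd_conv_nth nth_eq_iff_index_eq)
    finally show ?thesis .
  qed
  ultimately show ?R using d by auto
next
  assume R: ?R
  have h: "hd xs = xs ! 0" using assms by (simp add: hd_conv_nth)
  have d: "distinct xs" using R ipath_distinct by blast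
  have x: "E x (xs ! j) \<longleftrightarrow> j = 0" if "j < length xs" for j
    using R that d assms by (simp add: h nth_eq_iff_index_eq)
  show ?L
    unfolding induced_path_def
  proof (intro conjI allI impI)
    fix i j assume "i < length (x # xs)" "j < length (x # xs)"
    then show "E ((x # xs) ! i) ((x # xs) ! j) \<longleftrightarrow> i = Suc j \<or> j = Suc i"
      using x ipath_nth[of xs] R irrefl sym_iff[of _ x]
      by (cases i; cases j) (auto simp: sym_iff[of _ x])
  qed (use R d in auto)
qed

lemma ipath_append:
  assumes "ipath xs" "ipath ys" "set xs \<inter> set ys = {}"
    and "\<And>x y. x \<in> set xs \<Longrightarrow> y \<in> set ys \<Longrightarrow> E x y \<longleftrightarrow> x = last xs \<and> y = hd ys"
  shows "ipath (xs @ ys)"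
  using assms
proof (induction xs)
  case Nil
  then show ?case by simp
next
  case (Cons x xs)
  have ys: "ys \<noteq> []" using Cons.prems ipath_not_Nil by blast
  show ?case
  proof (cases "xs = []")
    case True
    then show ?thesis using Cons.prems ys by (auto simp: ipath_Cons)
  next
    case False
    have x: "ipath xs" "x \<notin> set xs" "\<forall>y\<in>set xs. E x y \<longleftrightarrow> y = hd xs"
      using Cons.prems(1) False by (auto simp: ipath_Cons)
    have "ipath (xs @ ys)"
      using Cons.IH x(1) Cons.prems False by auto
    moreover have "\<not> E x y" if "y \<in> set ys" for y
    proof -
      have "x \<noteq> last xs" using x(2) last_in_set[OF False] by blast
      then show ?thesis using Cons.prems(4)[of x y] that False by simp
    qed
    moreover have "hd xs \<notin> set ys" using Cons.prems(3) hd_in_set[OF False] by auto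
    ultimately show ?thesis
      using x False Cons.prems(3) by (auto simp: ipath_Cons)
  qed
qed

lemma ipath_rev [simp]: "ipath (rev xs) \<longleftrightarrow> ipath xs"
proof -
  have "ipath (rev xs)" if p: "ipath xs" for xs :: "'a list"
    unfolding induced_path_def
  proof (intro conjI allI impI)
    fix i j assume "i < length (rev xs)" "j < length (rev xs)"
    then show "E (rev xs ! i) (rev xs ! j) \<longleftrightarrow> i = Suc j \<or> j = Suc i"
      by (simp add: rev_nth ipath_nth[OF p]) arith
  qed (use p in \<open>auto simp: induced_path_def\<close>)
  from this[of xs] this[of "rev xs"] show ?thesis by auto
qed

section \<open>Contiguous segments of lists, with both end positions included\<close>

definition seg :: "'b list \<Rightarrow> nat \<Rightarrow> nat \<Rightarrow> 'b list" where
  "seg xs i j = take (Suc j - i) (drop i xs)"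

context
  fixes xs :: "'b list" and i j :: nat
  assumes ij: "i \<le> j" "j < length xs"
begin

lemma length_seg: "length (seg xs i j) = Suc j - i"
  using ij by (simp add: seg_def)

lemma seg_not_Nil: "seg xs i j \<noteq> []"
  using length_seg ij by (metis Suc_diff_le list.size(3) nat.distinct(1))

lemma nth_seg: "k \<le> j - i \<Longrightarrow> seg xs i j ! k = xs ! (i + k)"
  using ij by (simp add: seg_def)

lemma hd_seg: "hd (seg xs i j) = xs ! i"
  using nth_seg[of 0] seg_not_Nil by (simp add: hd_conv_nth)

lemma last_seg: "last (seg xs i j) = xs ! j"
  using nth_seg[of "j - i"] seg_not_Nil ij by (simp add: last_conv_nth length_seg Suc_diff_le)

lemma in_seg: "x \<in> set (seg xs i j) \<longleftrightarrow> (\<exists>k. i \<le> k \<and> k \<le> j \<and> x = xs ! k)"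
proof
  assume "x \<in> set (seg xs i j)"
  then obtain k where "k < Suc j - i" "x = seg xs i j ! k"
    by (auto simp: in_set_conv_nth length_seg)
  then show "\<exists>k. i \<le> k \<and> k \<le> j \<and> x = xs ! k"
    using nth_seg[of k] by (intro exI[of _ "i + k"]) auto
next
  assume "\<exists>k. i \<le> k \<and> k \<le> j \<and> x = xs ! k"
  then obtain k where "i \<le> k" "k \<le> j" "x = xs ! k" by blast
  then show "x \<in> set (seg xs i j)"
    using nth_seg[of "k - i"] by (auto simp: in_set_conv_nth length_seg intro!: exI[of _ "k - i"])
qed

end

lemma ipath_seg:
  assumes "ipath xs" "i \<le> j" "j < length xs"
  shows "ipath (seg xs i j)"
  unfolding induced_path_def
proof (intro conjI allI impI)
  fix k l assume "k < length (seg xs i j)" "l < length (seg xs i j)"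
  then show "E (seg xs i j ! k) (seg xs i j ! l) \<longleftrightarrow> k = Suc l \<or> l = Suc k"
    using assms by (simp add: length_seg nth_seg ipath_nth)
qed (use assms seg_not_Nil in \<open>auto simp: seg_def induced_path_def\<close>)

text \<open>The reachability relation is the one in \<open>component\<close>, so a component is
  connected by unfolding. The empty set counts as connected.\<close>

definition conn :: "'a set \<Rightarrow> bool" where
  "conn W \<longleftrightarrow> (\<forall>u\<in>W. \<forall>v\<in>W. (u, v) \<in> {(x, y). x \<in> W \<and> y \<in> W \<and> E x y}\<^sup>*)"

lemma conn_single [simp]: "conn {x}"
  by (simp add: conn_def)

lemma conn_Un:
  assumes "conn A" "conn B" "x \<in> A" "y \<in> B" "x = y \<or> E x y"
  shows "conn (A \<union> B)"
proof -
  let ?r = "\<lambda>W. {(x, y). x \<in> W \<and> y \<in> W \<and> E x y}"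
  have mono: "(?r A)\<^sup>* \<subseteq> (?r (A \<union> B))\<^sup>*" "(?r B)\<^sup>* \<subseteq> (?r (A \<union> B))\<^sup>*"
    by (rule rtrancl_mono, blast)+
  have A: "(u, v) \<in> (?r (A \<union> B))\<^sup>*" if "u \<in> A" "v \<in> A" for u v
    using assms(1) that mono(1) unfolding conn_def by blast
  have B: "(u, v) \<in> (?r (A \<union> B))\<^sup>*" if "u \<in> B" "v \<in> B" for u v
    using assms(2) that mono(2) unfolding conn_def by blast
  have xy: "(x, y) \<in> (?r (A \<union> B))\<^sup>*" "(y, x) \<in> (?r (A \<union> B))\<^sup>*"
    using assms(3-5) sym by (cases "x = y"; auto intro!: r_into_rtrancl)+
  show ?thesis
    unfolding conn_def
    using A B xy assms(3,4) rtrancl_trans by (metis (no_types, lifting) Un_iff)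
qed

lemma conn_ipath: "ipath xs \<Longrightarrow> conn (set xs)"
proof (induction xs)
  case Nil
  then show ?case by (simp add: conn_def)
next
  case (Cons x xs)
  show ?case
  proof (cases "xs = []")
    case False
    then have "ipath xs" "E x (hd xs)" using Cons.prems by (auto simp: ipath_Cons)
    then have "conn ({x} \<union> set xs)"
      using Cons.IH False by (intro conn_Un[of _ _ x "hd xs"]) auto
    then show ?thesis by simp
  qed simp
qed

lemma conn_neighbour:
  assumes "conn W" "x \<in> W" "y \<in> W" "x \<noteq> y"
  obtains z where "z \<in> W" "E z x"
proof -
  from assms have "(y, x) \<in> {(x, y). x \<in> W \<and> y \<in> W \<and> E x y}\<^sup>*"
    unfolding conn_def by blast
  then show ?thesis using assms(4) that by (auto elim: rtranclE)
qed

lemma conn_walk: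
  assumes "conn W" "x \<in> W" "y \<in> W"
  obtains zs where "zs \<noteq> []" "successively E zs" "set zs \<subseteq> W" "hd zs = x" "last zs = y"
proof -
  from assms have "(x, y) \<in> {(x, y). x \<in> W \<and> y \<in> W \<and> E x y}\<^sup>*"
    unfolding conn_def by blast
  then have "\<exists>zs. zs \<noteq> [] \<and> successively E zs \<and> set zs \<subseteq> W \<and> hd zs = x \<and> last zs = y"
  proof induction
    case base
    then show ?case using assms(2) by (intro exI[of _ "[x]"]) auto
  next
    case (step y z)
    then obtain zs where "zs \<noteq> []" "successively E zs" "set zs \<subseteq> W" "hd zs = x" "last zs = y"
      by blast
    then show ?case using step(2)
      by (intro exI[of _ "zs @ [z]"]) (auto simp: successively_append_iff)
  qed
  then show ?thesis using that by blast
qed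

lemma successively_shortcut:
  assumes "successively E zs" "i < length zs" "j < length zs" "E (zs ! i) (zs ! j)"
  shows "successively E (take (Suc i) zs @ drop j zs)"
proof -
  have "successively E (take (Suc i) zs)" "successively E (drop j zs)"
    using assms(1) by (metis append_take_drop_id successively_append_iff)+
  moreover have "last (take (Suc i) zs) = zs ! i" "hd (drop j zs) = zs ! j"
    using assms by (auto simp: take_Suc_conv_app_nth hd_drop_conv_nth)
  ultimately show ?thesis using assms by (auto simp: successively_append_iff)
qed

text \<open>The path is a walk of least length in \<open>W\<close> from a neighbour of
  \<open>Y\<close> to a neighbour of \<open>X\<close>: cutting off a beginning or an end, or jumping
  along a chord, would shorten it. Disjointness is conditional because a vertex of \<open>X\<close>
  lying in \<open>W\<close> may itself start the walk if it has a neighbour in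
  \<open>Y\<close>.\<close>

lemma shortest_path:
  assumes "conn W" "w \<in> W" "y \<in> Y" "E y w" "w' \<in> W" "x \<in> X" "E w' x"
  obtains ys where "ipath ys" "set ys \<subseteq> W"
    "\<And>v. v \<in> set ys \<Longrightarrow> (\<exists>y\<in>Y. E y v) \<longleftrightarrow> v = hd ys"
    "\<And>v. v \<in> set ys \<Longrightarrow> (\<exists>x\<in>X. E v x) \<longleftrightarrow> v = last ys"
    "(\<And>y x. y \<in> Y \<Longrightarrow> x \<in> X \<Longrightarrow> \<not> E y x) \<Longrightarrow> set ys \<inter> (X \<union> Y) = {}"
proof -
  define ok where "ok = (\<lambda>zs. zs \<noteq> [] \<and> successively E zs \<and> set zs \<subseteq> W
    \<and> (\<exists>y\<in>Y. E y (hd zs)) \<and> (\<exists>x\<in>X. E (last zs) x))"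
  obtain zs0 where "ok zs0"
    using conn_walk[OF assms(1,2,5)] assms(3,4,6,7) unfolding ok_def by metis
  then obtain zs where zs: "ok zs" and min: "\<And>us. ok us \<Longrightarrow> length zs \<le> length us"
    using ex_has_least_nat[of ok zs0 length] by blast
  have ne: "zs \<noteq> []" and succ: "successively E zs" and sub: "set zs \<subseteq> W"
    using zs by (auto simp: ok_def)
  have first: "i = 0" if "i < length zs" "\<exists>y\<in>Y. E y (zs ! i)" for i
  proof -
    have "ok (drop i zs)"
      unfolding ok_def
      using zs that set_drop_subset[of i zs]
      by (auto simp: ok_def hd_drop_conv_nth)
         (metis append_take_drop_id successively_append_iff)
    then show ?thesis using min[of "drop i zs"] that by auto
  qed
  have final: "Suc i = length zs" if "i < length zs" "\<exists>x\<in>X. E (zs ! i) x" for i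
  proof -
    have "hd (take (Suc i) zs) = hd zs" "last (take (Suc i) zs) = zs ! i"
      using that ne by (cases zs, auto simp: take_Suc_conv_app_nth)
    moreover have "successively E (take (Suc i) zs)"
      using succ by (metis append_take_drop_id successively_append_iff)
    ultimately have "ok (take (Suc i) zs)"
      using zs that set_take_subset[of "Suc i" zs] by (auto simp: ok_def)
    then show ?thesis using min[of "take (Suc i) zs"] that by auto
  qed
  have chord: "j \<le> Suc i" if "i < length zs" "j < length zs" "E (zs ! i) (zs ! j)" for i j
  proof (rule ccontr)
    assume "\<not> j \<le> Suc i"
    then have "length (take (Suc i) zs @ drop j zs) < length zs" using that by simp
    moreover have "ok (take (Suc i) zs @ drop j zs)"
      unfolding ok_def
      using zs that successively_shortcut[OF succ that]
        set_take_subset[of "Suc i" zs] set_drop_subset[of j zs]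
      by (auto simp: ok_def)
    ultimately show False using min by (meson not_less)
  qed
  \<comment> \<open>A repeated vertex would inherit the edge leaving its later occurrence, which is
    a chord; if that occurrence ends the walk, the earlier one would already see
    \<open>X\<close>.\<close>
  have dist: "zs ! i \<noteq> zs ! j" if "i < j" "j < length zs" for i j
  proof (cases "Suc j < length zs")
    case True
    then have "E (zs ! j) (zs ! Suc j)"
      using succ by (auto simp: successively_conv_nth)
    then show ?thesis using chord[of i "Suc j"] that True by auto
  next
    case False
    then have "zs ! j = last zs" using that ne by (metis Suc_lessI diff_Suc_1 last_conv_nth)
    moreover obtain x where "x \<in> X" "E (last zs) x" using zs by (auto simp: ok_def)
    moreover have "Suc i \<noteq> length zs" using that by simp
    ultimately show ?thesis using final[of i] that by (metis order.strict_trans)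
  qed
  have "ipath zs"
    unfolding induced_path_def
  proof (intro conjI allI impI)
    show "distinct zs" using dist by (metis distinct_conv_nth nat_neq_iff)
    fix i j assume ij: "i < length zs" "j < length zs"
    show "E (zs ! i) (zs ! j) \<longleftrightarrow> i = Suc j \<or> j = Suc i"
    proof
      assume e: "E (zs ! i) (zs ! j)"
      then have "i \<noteq> j" using irrefl by auto
      then show "i = Suc j \<or> j = Suc i"
        using chord[OF ij e] chord[OF ij(2,1) sym[OF e]] by auto
    next
      assume "i = Suc j \<or> j = Suc i"
      then show "E (zs ! i) (zs ! j)"
        using succ ij sym by (auto simp: successively_conv_nth)
    qed
  qed (use ne in auto)
  then show ?thesis
  proof (rule that[OF _ sub])
    fix v assume "v \<in> set zs"
    then obtain i where i: "i < length zs" "v = zs ! i" by (auto simp: in_set_conv_nth)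
    show "(\<exists>y\<in>Y. E y v) \<longleftrightarrow> v = hd zs"
      using first[of i] i zs ne by (auto simp: ok_def hd_conv_nth)
    show "(\<exists>x\<in>X. E v x) \<longleftrightarrow> v = last zs"
    proof
      assume "\<exists>x\<in>X. E v x"
      then have "Suc i = length zs" using final[of i] i by simp
      then show "v = last zs" using i ne by (metis diff_Suc_1 last_conv_nth)
    qed (use zs in \<open>auto simp: ok_def\<close>)
  next
    assume no: "\<And>y x. y \<in> Y \<Longrightarrow> x \<in> X \<Longrightarrow> \<not> E y x"
    have step: "E (zs ! k) (zs ! Suc k)" if "Suc k < length zs" for k
      using succ that by (auto simp: successively_conv_nth)
    have "zs ! i \<notin> X" if i: "i < length zs" for i
    proof (cases i)
      case 0
      then show ?thesis using no zs ne by (auto simp: ok_def hd_conv_nth)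
    next
      case (Suc k)
      then show ?thesis using final[of k] step[of k] i by auto
    qed
    moreover have "zs ! i \<notin> Y" if i: "i < length zs" for i
    proof (cases "Suc i < length zs")
      case True
      then show ?thesis using first[of "Suc i"] step[of i] by auto
    next
      case False
      then have "zs ! i = last zs" using i ne by (metis Suc_lessI diff_Suc_1 last_conv_nth)
      then show ?thesis using no zs by (auto simp: ok_def)
    qed
    ultimately show "set zs \<inter> (X \<union> Y) = {}" by (auto simp: in_set_conv_nth)
  qed
qed

text \<open>The list \<open>xs\<close> together with the edge \<open>u v\<close> closes up to an induced cycle.\<close>

definition hole :: "'a \<Rightarrow> 'a \<Rightarrow> 'a list \<Rightarrow> bool" where
  "hole u v xs \<longleftrightarrow> ipath xs \<and> 2 \<le> length xs \<and> E u v \<and> u \<notin> set xs \<and> v \<notin> set xs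
    \<and> (\<forall>x\<in>set xs. (E u x \<longleftrightarrow> x = hd xs) \<and> (E v x \<longleftrightarrow> x = last xs))"

lemma hole_rev: "hole u v xs \<Longrightarrow> hole v u (rev xs)"
  by (auto simp: hole_def hd_rev last_rev sym)

context
  fixes u v xs
  assumes h: "hole u v xs"
begin

lemma hole_ipath: "ipath xs"
  and hole_length: "2 \<le> length xs"
  and hole_edge: "E u v"
  and hole_notin: "u \<notin> set xs" "v \<notin> set xs"
  using h by (auto simp: hole_def)

lemma hole_not_Nil: "xs \<noteq> []"
  using hole_length by auto

lemma hole_nth_eq: "i < length xs \<Longrightarrow> j < length xs \<Longrightarrow> xs ! i = xs ! j \<longleftrightarrow> i = j"
  using ipath_distinct[OF hole_ipath] by (simp add: nth_eq_iff_index_eq)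

lemma hole_nth: "i < length xs \<Longrightarrow> j < length xs \<Longrightarrow> E (xs ! i) (xs ! j) \<longleftrightarrow> i = Suc j \<or> j = Suc i"
  using ipath_nth[OF hole_ipath] .

lemma hole_left: "i < length xs \<Longrightarrow> E u (xs ! i) \<longleftrightarrow> i = 0"
  using h hole_nth_eq[of i 0] hole_not_Nil by (auto simp: hole_def hd_conv_nth)

lemma hole_right: "i < length xs \<Longrightarrow> E v (xs ! i) \<longleftrightarrow> Suc i = length xs"
  using h hole_nth_eq[of i "length xs - 1"] hole_not_Nil
  by (auto simp: hole_def last_conv_nth)

lemma hole_nth_neq: "i < length xs \<Longrightarrow> xs ! i \<noteq> u" "i < length xs \<Longrightarrow> xs ! i \<noteq> v"
  using hole_notin by auto

end

end

section \<open>Linking a vertex to a hole\<close>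

text \<open>The vertex set is dropped: a vertex on an edge lies in \<open>V\<close> anyway, so
  holes, C4s and prisms do not notice the difference. Since \<open>length xs\<close> is two less
  than the length of the cycle, \<open>even_hole\<close> says that there are no odd holes.\<close>

locale prism_free_graph = simple_graph +
  assumes even_hole: "hole u v xs \<Longrightarrow> even (length xs)"
    and no_C4: "\<not> has_induced_C4 UNIV E"
    and no_prism: "\<not> has_induced_prism UNIV E"
begin

lemma C4_free:
  assumes "E w x" "E x y" "E y z" "E z w" "w \<noteq> y" "x \<noteq> z" "\<not> E w y" "\<not> E x z"
  shows False
proof -
  have "distinct [w, x, y, z]" using assms irrefl by auto
  then show False using assms no_C4 unfolding has_induced_C4_def by blast
qed

lemma prism_free:
  assumes "ipath P" "ipath Q" "ipath R"
    and "prism_paths_ok E P Q" "prism_paths_ok E P R" "prism_paths_ok E Q R"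
    and "{hd P, hd Q, hd R} \<inter> {last P, last Q, last R} = {}"
    and "E (hd P) (hd Q)" "E (hd Q) (hd R)" "E (hd P) (hd R)"
    and "E (last P) (last Q)" "E (last Q) (last R)" "E (last P) (last R)"
  shows False
  using assms no_prism unfolding has_induced_prism_def by blast

text \<open>The cycle runs from \<open>u\<close> along the hole to the first neighbour of
  \<open>last ys\<close>, back along \<open>ys\<close> to \<open>t\<close>, and through the edge
  \<open>t u\<close>. Later neighbours of \<open>last ys\<close> on the hole do not matter, so the
  lemma can be used from both ends of the hole.\<close>

lemma even_first_attachment:
  assumes h: "hole u v xs"
    and t: "t \<notin> set xs" "E t u" "\<And>x. x \<in> set xs \<Longrightarrow> \<not> E t x"
    and ys: "ipath ys" "set ys \<inter> set xs = {}" "t \<notin> set ys" "u \<notin> set ys"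
    and ty: "\<And>y. y \<in> set ys \<Longrightarrow> E t y \<longleftrightarrow> y = hd ys"
    and uy: "\<And>y. y \<in> set ys \<Longrightarrow> \<not> E u y"
    and yx: "\<And>y x. y \<in> set ys \<Longrightarrow> x \<in> set xs \<Longrightarrow> E y x \<Longrightarrow> y = last ys"
    and i: "i < length xs" "E (last ys) (xs ! i)" "\<And>k. k < i \<Longrightarrow> \<not> E (last ys) (xs ! k)"
  shows "even (Suc i + length ys)"
proof -
  have ne: "ys \<noteq> []" using ys(1) ipath_not_Nil by blast
  let ?p = "seg xs 0 i"
  have inp: "x \<in> set ?p \<longleftrightarrow> (\<exists>k\<le>i. x = xs ! k)" for x
    using in_seg[of 0 i xs] i(1) by auto
  have sub: "set ?p \<subseteq> set xs" using inp i(1) by auto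
  have pne: "?p \<noteq> []" using seg_not_Nil[of 0 i xs] i(1) by simp
  have hp: "hd ?p = xs ! 0" "last ?p = xs ! i" using hd_seg[of 0 i xs] last_seg[of 0 i xs] i(1) by auto
  have "ipath (?p @ rev ys)"
  proof (rule ipath_append)
    fix x y assume x: "x \<in> set ?p" and y: "y \<in> set (rev ys)"
    then obtain k where k: "k \<le> i" "x = xs ! k" using inp by blast
    have *: "E (last ys) (xs ! k) \<longleftrightarrow> k = i" using i k by (metis le_neq_implies_less)
    have **: "xs ! k = xs ! i \<longleftrightarrow> k = i" using hole_nth_eq[OF h, of k i] i(1) k by simp
    have "E y x \<longleftrightarrow> x = last ?p \<and> y = hd (rev ys)"
      using * ** yx[of y x] y k x sub by (auto simp: hp hd_rev)
    then show "E x y \<longleftrightarrow> x = last ?p \<and> y = hd (rev ys)" by (simp add: sym_iff[of x y])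
  qed (use ys sub ipath_seg[OF hole_ipath[OF h]] i(1) in auto)
  moreover have "E u (xs ! 0)" using hole_left[OF h, of 0] i(1) by (cases xs) auto
  moreover have "E u x \<longleftrightarrow> x = xs ! 0" if "x \<in> set ?p" for x
    using that inp hole_left[OF h] hole_nth_eq[OF h] i(1) by fastforce
  moreover have "xs ! 0 \<notin> set ys" "hd ys \<notin> set ?p" using ys(2) i(1) sub ne
    by (auto simp: disjoint_iff) (metis gr_zeroI not_less_zero nth_mem less_trans)
  moreover have "2 \<le> length (?p @ rev ys)"
    using length_seg[of 0 i xs] i(1) ne by (cases ys) auto
  ultimately have "hole u t (?p @ rev ys)"
    unfolding hole_def
    using t ys uy ty sub hole_notin[OF h] ne pne hp
    by (auto simp: last_rev sym)
  from even_hole[OF this] show ?thesis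
    using length_seg[of 0 i xs] i(1) by simp
qed

text \<open>Depending on the neighbours of the last vertex of a path from \<open>t\<close> to the hole, the path
  and the hole form a pyramid, a prism, or a pyramid whose apex is that last vertex.\<close>

lemma no_link:
  assumes h: "hole u v xs"
    and t: "t \<notin> set xs" "E t u" "E t v" "\<And>x. x \<in> set xs \<Longrightarrow> \<not> E t x"
    and T: "conn T" "t \<notin> T" "w \<in> T" "E t w" "w' \<in> T" "x \<in> set xs" "E w' x"
    and uT: "\<And>w. w \<in> T \<Longrightarrow> w \<noteq> u \<and> \<not> E u w"
    and vT: "\<And>w. w \<in> T \<Longrightarrow> w \<noteq> v \<and> \<not> E v w"
  shows False
proof -
  obtain ys where ys: "ipath ys" "set ys \<subseteq> T"
    and ty0: "\<And>y. y \<in> set ys \<Longrightarrow> (\<exists>y'\<in>{t}. E y' y) \<longleftrightarrow> y = hd ys"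
    and yx: "\<And>y. y \<in> set ys \<Longrightarrow> (\<exists>x\<in>set xs. E y x) \<longleftrightarrow> y = last ys"
    and dis: "set ys \<inter> (set xs \<union> {t}) = {}"
    using shortest_path[OF T(1,3) _ T(4,5,6,7), of "{t}"] t(4)
    by (smt (verit, best) singletonD singletonI)
  have ty: "\<And>y. y \<in> set ys \<Longrightarrow> E t y \<longleftrightarrow> y = hd ys" using ty0 by simp
  have ne: "ys \<noteq> []" using ys(1) ipath_not_Nil by blast
  define q where "q = last ys"
  have qys: "q \<in> set ys" using ne by (simp add: q_def)
  have uy: "u \<notin> set ys" "\<And>y. y \<in> set ys \<Longrightarrow> \<not> E u y" using uT ys(2) by blast+
  have vy: "v \<notin> set ys" "\<And>y. y \<in> set ys \<Longrightarrow> \<not> E v y" using vT ys(2) by blast+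
  have yl: "\<And>y x. y \<in> set ys \<Longrightarrow> x \<in> set xs \<Longrightarrow> E y x \<Longrightarrow> y = last ys" using yx by blast
  define n where "n = length xs"
  define I where "I = {k. k < n \<and> E q (xs ! k)}"
  have "\<exists>x\<in>set xs. E q x" using yx qys by (simp add: q_def)
  then have I: "finite I" "I \<noteq> {}" by (auto simp: I_def n_def in_set_conv_nth)
  define i j where "i = Min I" and "j = Max I"
  have ij: "i \<le> j" "j < n" "E q (xs ! i)" "E q (xs ! j)"
    using Min_in[OF I] Max_in[OF I] Min_le[OF I(1)] by (auto simp: I_def i_def j_def)
  have lo: "i \<le> k" "k \<le> j" if "k < n" "E q (xs ! k)" for k
    using that I(1) by (auto simp: i_def j_def I_def)
  have n2: "2 \<le> n" and en: "even n" using hole_length[OF h] even_hole[OF h] by (auto simp: n_def)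
  have e1: "even (Suc i + length ys)"
  proof (rule even_first_attachment[OF h t(1,2,4) ys(1) _ _ uy(1) ty uy(2) yl])
    show "\<not> E (last ys) (xs ! k)" if "k < i" for k
      using that lo(1)[of k] ij by (auto simp: q_def)
  qed (use dis ij in \<open>auto simp: n_def q_def\<close>)
  have rn: "rev xs ! k = xs ! (n - 1 - k)" if "k < n" for k
    using that by (simp add: rev_nth n_def)
  \<comment> \<open>In the reversed hole the last attachment \<open>j\<close> becomes the first one,
    at position \<open>n - 1 - j\<close>, and \<open>v\<close> takes the part of
    \<open>u\<close>.\<close>
  have e2: "even (Suc (n - 1 - j) + length ys)"
  proof (rule even_first_attachment[OF hole_rev[OF h] _ t(3) _ ys(1) _ _ vy(1) ty vy(2) _])
    show "E (last ys) (rev xs ! (n - 1 - j))" using ij by (simp add: rn q_def)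
    show "\<not> E (last ys) (rev xs ! k)" if "k < n - 1 - j" for k
      using that lo(2)[of "n - 1 - k"] rn[of k] by (auto simp: q_def)
    show "n - 1 - j < length (rev xs)" using ij by (simp add: n_def)
  qed (use t dis yl in auto)
  let ?p = "seg xs 0 i" and ?r = "seg xs j (n - 1)"
  have inp: "x \<in> set ?p \<longleftrightarrow> (\<exists>k\<le>i. x = xs ! k)" for x
    using in_seg[of 0 i xs] ij by (auto simp: n_def)
  have inr: "x \<in> set ?r \<longleftrightarrow> (\<exists>k<n. j \<le> k \<and> x = xs ! k)" for x
  proof -
    have "k \<le> n - 1 \<longleftrightarrow> k < n" for k using ij by auto
    then show ?thesis using in_seg[of j "n - 1" xs x] ij unfolding n_def by auto
  qed
  have hp: "hd ?p = xs ! 0" "last ?p = xs ! i" "?p \<noteq> []" "length ?p = Suc i" "ipath ?p"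
    using hd_seg[of 0 i xs] last_seg[of 0 i xs] seg_not_Nil[of 0 i xs] length_seg[of 0 i xs]
      ipath_seg[OF hole_ipath[OF h], of 0 i] ij by (auto simp: n_def)
  have hr: "hd ?r = xs ! j" "last ?r = xs ! (n - 1)" "?r \<noteq> []" "length ?r = n - j" "ipath ?r"
    using hd_seg[of j "n - 1" xs] last_seg[of j "n - 1" xs] seg_not_Nil[of j "n - 1" xs]
      length_seg[of j "n - 1" xs] ipath_seg[OF hole_ipath[OF h], of j "n - 1"] ij by (auto simp: n_def)
  have sub: "set ?p \<subseteq> set xs" "set ?r \<subseteq> set xs" using inp inr ij by (auto simp: n_def)
  have adj: "E (xs ! k) (xs ! l) \<longleftrightarrow> k = Suc l \<or> l = Suc k" if "k < n" "l < n" for k l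
    using hole_nth[OF h] that by (simp add: n_def)
  have eq: "xs ! k = xs ! l \<longleftrightarrow> k = l" if "k < n" "l < n" for k l
    using hole_nth_eq[OF h] that by (simp add: n_def)
  have left: "E u (xs ! k) \<longleftrightarrow> k = 0" and right: "E v (xs ! k) \<longleftrightarrow> k = n - 1" if "k < n" for k
    using hole_left[OF h] hole_right[OF h] that by (auto simp: n_def)
  have qx: "q \<notin> set xs" using qys dis by blast
  have prs: "E x y \<longleftrightarrow> j = Suc i \<and> x = xs ! i \<and> y = xs ! j"
    if "x \<in> set ?p" "y \<in> set ?r" "i < j" for x y
  proof -
    from that obtain k l where kl: "k \<le> i" "x = xs ! k" "l < n" "j \<le> l" "y = xs ! l"
      using inp inr by blast
    then have "E x y \<longleftrightarrow> l = Suc k" using adj[of k l] that(3) by auto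
    also have "\<dots> \<longleftrightarrow> j = Suc i \<and> k = i \<and> l = j" using kl that(3) by auto
    finally show ?thesis using kl that(3) eq[of k i] eq[of l j] ij by auto
  qed
  have prd: "set ?p \<inter> set ?r = {}" if "i < j"
  proof (rule ccontr)
    assume "\<not> ?thesis"
    then obtain k l where "k \<le> i" "l < n" "j \<le> l" "xs ! k = xs ! l" using inp inr by auto
    then show False using eq[of k l] that by auto
  qed
  have up: "E u x \<longleftrightarrow> x = xs ! 0" if "x \<in> set ?p" for x
  proof -
    from that obtain k where "k \<le> i" "x = xs ! k" using inp by blast
    then show ?thesis using left[of k] eq[of k 0] ij by auto
  qed
  have vr: "E v x \<longleftrightarrow> x = xs ! (n - 1)" if "x \<in> set ?r" for x
  proof -
    from that obtain k where "k < n" "x = xs ! k" using inr by blast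
    then show ?thesis using right[of k] eq[of k "n - 1"] n2 by auto
  qed
  have ur: "\<not> E u x" if x: "x \<in> set ?r" and "i < j" for x
  proof -
    from x obtain k where "k < n" "j \<le> k" "x = xs ! k" using inr by blast
    then show ?thesis using left[of k] \<open>i < j\<close> by auto
  qed
  have vp: "\<not> E v x" if x: "x \<in> set ?p" and "i < j" for x
  proof -
    from x obtain k where "k \<le> i" "x = xs ! k" using inp by blast
    then show ?thesis using right[of k] \<open>i < j\<close> ij by auto
  qed
  have qp: "E q x \<longleftrightarrow> x = xs ! i" if "x \<in> set ?p" for x
  proof -
    from that obtain k where "k \<le> i" "x = xs ! k" using inp by blast
    then show ?thesis using lo(1)[of k] eq[of k i] ij by auto
  qed
  have qr: "E q x \<longleftrightarrow> x = xs ! j" if "x \<in> set ?r" for x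
  proof -
    from that obtain k where "k < n" "j \<le> k" "x = xs ! k" using inr by blast
    then show ?thesis using lo(2)[of k] eq[of k j] ij by auto
  qed
  have uv: "E u v" "u \<noteq> v" using hole_edge[OF h] irrefl by auto
  have tu: "t \<noteq> u" "t \<noteq> v" using t irrefl by auto
  have nin: "u \<notin> set ?p" "v \<notin> set ?p" "u \<notin> set ?r" "v \<notin> set ?r" "t \<notin> set ?p" "t \<notin> set ?r"
    "q \<notin> set ?p" "q \<notin> set ?r"
    using hole_notin[OF h] sub t(1) qx by auto
  \<comment> \<open>By \<open>e1\<close>, \<open>e2\<close> and evenness of \<open>n\<close>, the
    positions \<open>i\<close> and \<open>j\<close> have opposite parity. This excludes the first
    case, and in the third it makes the hole rerouted through \<open>q\<close> odd.\<close>
  consider "i = j" | "j = Suc i" | "Suc (Suc i) \<le> j" using ij by linarith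
  then show False
  proof cases
    case 1
    then show False using e1 e2 en ij by presburger
  next
    case 2
    have "i < j" using 2 by simp
    note prd = prd[OF this] and prs = prs[OF _ _ this] and ur = ur[OF _ this] and vp = vp[OF _ this]
    have yp: "E x y \<longleftrightarrow> x = xs ! i \<and> y = q" if "x \<in> set ?p" "y \<in> set ys" for x y
      using that qp[of x] yl[of y x] sub(1) unfolding sym_iff[of x y] by (auto simp: q_def)
    have yr: "E x y \<longleftrightarrow> x = xs ! j \<and> y = q" if "x \<in> set ?r" "y \<in> set ys" for x y
      using that qr[of x] yl[of y x] sub(2) unfolding sym_iff[of x y] by (auto simp: q_def)
    have pt: "\<not> E x t" if "x \<in> set ?p \<union> set ?r" for x
      using that t(4)[of x] sub sym by blast
    have pv: "\<not> E x v" if "x \<in> set ?p" for x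
      using that vp[of x] sym by blast
    \<comment> \<open>The triangles of the prism are \<open>u v t\<close> and \<open>xs ! i\<close>,
      \<open>xs ! j\<close>, \<open>q\<close>; its paths are the two ends of the hole and
      \<open>t # ys\<close>.\<close>
    have P1: "ipath (u # ?p)"
      using hp up nin by (auto simp: ipath_Cons)
    have P2: "ipath (v # rev ?r)"
      using hr vr nin by (auto simp: ipath_Cons hd_rev)
    have P3: "ipath (t # ys)"
      using ys(1) ty dis ne by (auto simp: ipath_Cons)
    have l: "last (u # ?p) = xs ! i" "last (v # rev ?r) = xs ! j" "last (t # ys) = q"
      using hp hr ne by (auto simp: last_rev q_def)
    have xin: "xs ! i \<in> set ?p" "xs ! j \<in> set ?r" using inp inr ij by auto
    have x: "xs ! i \<noteq> u" "xs ! i \<noteq> t" "xs ! j \<noteq> v" "xs ! j \<noteq> t" "q \<noteq> u" "q \<noteq> v" "q \<noteq> t"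
      "xs ! i \<noteq> v" "xs ! j \<noteq> u"
      using xin nin uy(1) vy(1) qys dis by auto
    have O1: "prism_paths_ok E (u # ?p) (v # rev ?r)"
      unfolding prism_paths_ok_def l
    proof (intro conjI ballI)
      show "set (u # ?p) \<inter> set (v # rev ?r) = {}" using prd nin uv by auto
      fix y z assume "y \<in> set (u # ?p)" "z \<in> set (v # rev ?r)"
      then have "(y = u \<or> y \<in> set ?p) \<and> (z = v \<or> z \<in> set ?r)" by simp
      then show "E y z \<longleftrightarrow> y = hd (u # ?p) \<and> z = hd (v # rev ?r) \<or> y = xs ! i \<and> z = xs ! j"
        using uv ur[of z] pv[of y] prs[of y z] nin x 2 by (elim conjE disjE) auto
    qed
    have O2: "prism_paths_ok E (u # ?p) (t # ys)"
      unfolding prism_paths_ok_def l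
    proof (intro conjI ballI)
      show "set (u # ?p) \<inter> set (t # ys) = {}" using nin uy(1) tu dis sub(1) by auto
      fix y z assume "y \<in> set (u # ?p)" "z \<in> set (t # ys)"
      then have "(y = u \<or> y \<in> set ?p) \<and> (z = t \<or> z \<in> set ys)" by simp
      then show "E y z \<longleftrightarrow> y = hd (u # ?p) \<and> z = hd (t # ys) \<or> y = xs ! i \<and> z = q"
        using sym[OF t(2)] uy(2)[of z] pt[of y] yp[of y z] nin dis x by (elim conjE disjE) auto
    qed
    have O3: "prism_paths_ok E (v # rev ?r) (t # ys)"
      unfolding prism_paths_ok_def l
    proof (intro conjI ballI)
      show "set (v # rev ?r) \<inter> set (t # ys) = {}" using nin vy(1) tu dis sub(2) by auto
      fix y z assume "y \<in> set (v # rev ?r)" "z \<in> set (t # ys)"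
      then have "(y = v \<or> y \<in> set ?r) \<and> (z = t \<or> z \<in> set ys)" by simp
      then show "E y z \<longleftrightarrow> y = hd (v # rev ?r) \<and> z = hd (t # ys) \<or> y = xs ! j \<and> z = q"
        using sym[OF t(3)] vy(2)[of z] pt[of y] yr[of y z] nin dis x by (elim conjE disjE) auto
    qed
    have "E (xs ! i) (xs ! j)" "E (xs ! j) q" "E (xs ! i) q"
      using adj[of i j] 2 ij sym by auto
    moreover have "{u, v, t} \<inter> {xs ! i, xs ! j, q} = {}"
      using x xin nin by auto
    ultimately show False
      using prism_free[OF P1 P2 P3 O1 O2 O3] uv sym[OF t(2)] sym[OF t(3)] unfolding l list.sel(1)
      by simp
  next
    case 3
    have "i < j" using 3 by simp
    note prd = prd[OF this] and prs = prs[OF _ _ this] and ur = ur[OF _ this] and vp = vp[OF _ this]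
    have xin: "xs ! j \<in> set ?r" using inr ij by auto
    have "ipath (q # ?r)" using hr qr nin by (auto simp: ipath_Cons)
    have "ipath (?p @ q # ?r)"
    proof (rule ipath_append[OF hp(5) \<open>ipath (q # ?r)\<close>])
      show "set ?p \<inter> set (q # ?r) = {}" using prd nin by auto
      fix x y assume x: "x \<in> set ?p" and "y \<in> set (q # ?r)"
      then have "y = q \<or> y \<in> set ?r" by simp
      then show "E x y \<longleftrightarrow> x = last ?p \<and> y = hd (q # ?r)"
        using x prs[of x y] qp[of x] sym_iff[of x q] 3 nin hp by (elim disjE) auto
    qed
    moreover have "q \<noteq> u" "q \<noteq> v" "\<not> E u q" "\<not> E v q" "xs ! 0 \<notin> set ?r" "xs ! (n - 1) \<notin> set ?p"
      "q \<noteq> xs ! 0" "q \<noteq> xs ! (n - 1)"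
      using qys uy vy prd hd_in_set[OF hp(3)] last_in_set[OF hr(3)] hp(1) hr(2) nin by auto
    ultimately have "hole u v (?p @ q # ?r)"
      unfolding hole_def
      using hp hr uv nin up vr ur vp by auto
    from even_hole[OF this] have "even (Suc i + 1 + (n - j))" using hp hr by simp
    then show False using e1 e2 en ij by presburger
  qed
qed

section \<open>Two nonadjacent vertices attached to a common hole\<close>

lemma even_seg:
  assumes "ipath xs" "i < j" "j < length xs" "E x y"
    and "\<And>k. i \<le> k \<Longrightarrow> k \<le> j \<Longrightarrow> xs ! k \<noteq> x \<and> (E x (xs ! k) \<longleftrightarrow> k = i)"
    and "\<And>k. i \<le> k \<Longrightarrow> k \<le> j \<Longrightarrow> xs ! k \<noteq> y \<and> (E y (xs ! k) \<longleftrightarrow> k = j)"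
  shows "even (Suc j - i)"
proof -
  have s: "i \<le> j" "j < length xs" using assms by auto
  have eq: "xs ! k = xs ! l \<longleftrightarrow> k = l" if "k \<le> j" "l \<le> j" for k l
    using that assms(3) ipath_distinct[OF assms(1)] by (simp add: nth_eq_iff_index_eq)
  have "hole x y (seg xs i j)"
    unfolding hole_def
    using assms s eq by (auto simp: ipath_seg length_seg[OF s] hd_seg[OF s] last_seg[OF s] in_seg[OF s])
  from even_hole[OF this] show ?thesis by (simp add: length_seg[OF s])
qed

text \<open>Here the segment is closed by the path \<open>x y z\<close> instead of an edge. For
  \<open>i = j\<close> the cycle has four vertices, so \<open>i \<le> j\<close> suffices, whereas
  \<open>even_seg\<close> needs \<open>i < j\<close> to stay clear of triangles.\<close>

lemma even_seg_snoc:
  assumes "ipath xs" "i \<le> j" "j < length xs" "E x y" "E y z" "\<not> E x z" "x \<noteq> z"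
    and "\<And>k. i \<le> k \<Longrightarrow> k \<le> j \<Longrightarrow> xs ! k \<noteq> x \<and> (E x (xs ! k) \<longleftrightarrow> k = i)"
    and "\<And>k. i \<le> k \<Longrightarrow> k \<le> j \<Longrightarrow> xs ! k \<noteq> y \<and> \<not> E y (xs ! k)"
    and "\<And>k. i \<le> k \<Longrightarrow> k \<le> j \<Longrightarrow> xs ! k \<noteq> z \<and> (E z (xs ! k) \<longleftrightarrow> k = j)"
  shows "even (j - i)"
proof -
  note s = assms(2,3)
  have eq: "xs ! k = xs ! l \<longleftrightarrow> k = l" if "k \<le> j" "l \<le> j" for k l
    using that assms(3) ipath_distinct[OF assms(1)] by (simp add: nth_eq_iff_index_eq)
  have "E (xs ! k) z \<longleftrightarrow> k = j" if "i \<le> k" "k \<le> j" for k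
    using assms(10)[of k] that sym_iff[of z] by simp
  then have "ipath (seg xs i j @ [z])"
    using assms eq by (intro ipath_append) (auto simp: ipath_seg last_seg[OF s] in_seg[OF s])
  moreover have "y \<noteq> z" using assms(5) irrefl by auto
  ultimately have "hole x y (seg xs i j @ [z])"
    unfolding hole_def
    using assms s eq seg_not_Nil[OF s]
    by (auto simp: length_seg[OF s] hd_seg[OF s] in_seg[OF s])
  from even_hole[OF this] show ?thesis using s by (simp add: length_seg[OF s] Suc_diff_le)
qed

text \<open>\<open>M True\<close> and \<open>M False\<close> mark the positions on a path of the neighbours of two vertices;
  the parity assumptions say that the cycles formed by segments of the path are even.\<close>

lemma alternation_odd:
  fixes M :: "bool \<Rightarrow> nat \<Rightarrow> bool"
  assumes sector: "\<And>s q g. M s q \<Longrightarrow> M s g \<Longrightarrow> 1 \<le> q \<Longrightarrow> q + 2 \<le> g \<Longrightarrow> g \<le> n \<Longrightarrow>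
      (\<And>k. q < k \<Longrightarrow> k < g \<Longrightarrow> \<not> M s k) \<Longrightarrow> even (g - q)"
    and cross: "\<And>s w g. M s w \<Longrightarrow> M (\<not> s) g \<Longrightarrow> 1 \<le> w \<Longrightarrow> w < g \<Longrightarrow> g \<le> n \<Longrightarrow>
      (\<And>k. w < k \<Longrightarrow> k < g \<Longrightarrow> \<not> M s k \<and> \<not> M (\<not> s) k) \<Longrightarrow> even (g - w)"
    and disj: "\<And>s k. 1 \<le> k \<Longrightarrow> k \<le> n \<Longrightarrow> M s k \<Longrightarrow> \<not> M (\<not> s) k"
    and first: "\<And>s w g. M s g \<Longrightarrow> g \<le> n \<Longrightarrow> (\<And>k. 1 \<le> k \<Longrightarrow> k < g \<Longrightarrow> \<not> M s k) \<Longrightarrow>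
      M (\<not> s) w \<Longrightarrow> 1 \<le> w \<Longrightarrow> w < g \<Longrightarrow> odd g"
  shows "M s w \<Longrightarrow> M (\<not> s) g \<Longrightarrow> 1 \<le> w \<Longrightarrow> w < g \<Longrightarrow> g \<le> n \<Longrightarrow>
      (\<And>k. w < k \<Longrightarrow> k < g \<Longrightarrow> \<not> M s k \<and> \<not> M (\<not> s) k) \<Longrightarrow> odd g"
proof (induction g arbitrary: s w rule: less_induct)
  case (less g)
  note gap = less.prems(6)
  have no_g: "\<not> M (\<not> s) k" if "w \<le> k" "k < g" for k
    using gap[of k] disj[of w s] less.prems that by (cases "k = w") auto
  show ?case
  proof (rule ccontr)
    assume "\<not> odd g"
    define Q where "Q = {k. 1 \<le> k \<and> k < w \<and> M (\<not> s) k}"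
    have fQ: "finite Q" by (simp add: Q_def)
    show False
    proof (cases "Q = {}")
      case True
      then have "\<not> M (\<not> s) k" if "1 \<le> k" "k < g" for k
        using no_g[of k] that by (cases "k < w") (auto simp: Q_def)
      then show False using first[of "\<not> s" g w] less.prems \<open>\<not> odd g\<close> by simp
    next
      case False
      \<comment> \<open>\<open>q\<close> is the last position before \<open>w\<close> of the same
        kind as \<open>g\<close>, so \<open>q\<close> and \<open>g\<close> bound a sector. From
        \<open>q\<close> to the next position \<open>w'\<close> of the other kind there is an
        earlier alternation: \<open>w'\<close> is odd by induction, and both \<open>w' - q\<close>
        and \<open>g - q\<close> are even.\<close>
      define q where "q = Max Q"
      have q: "1 \<le> q" "q < w" "M (\<not> s) q"
        using Max_in[OF fQ False] by (auto simp: q_def Q_def)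
      have noq: "\<not> M (\<not> s) k" if "q < k" "k < g" for k
      proof (cases "k < w")
        case True
        then have "k \<notin> Q" using Max_ge[OF fQ, of k] that(1) by (auto simp: q_def)
        then show ?thesis using True that(1) q(1) by (simp add: Q_def)
      qed (use no_g[of k] that in simp)
      have "even (g - q)"
        using sector[of "\<not> s" q g] noq q less.prems by simp
      define w' where "w' = (LEAST k. q < k \<and> M s k)"
      have w': "q < w'" "M s w'" "w' \<le> w"
        using LeastI[of "\<lambda>k. q < k \<and> M s k" w] Least_le[of "\<lambda>k. q < k \<and> M s k" w] q less.prems
        by (auto simp: w'_def)
      have now': "\<not> M (\<not> s) k \<and> \<not> M s k" if "q < k" "k < w'" for k
        using not_less_Least[of k "\<lambda>k. q < k \<and> M s k"] noq[of k] that w'(3) less.prems(4)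
        by (auto simp: w'_def)
      have "odd w'"
        by (rule less.IH[of w' "\<not> s" q]) (use w' q less.prems now' in auto)
      moreover have "even (w' - q)"
        by (rule cross[of "\<not> s" q w']) (use w' q less.prems now' in auto)
      ultimately show False using \<open>even (g - q)\<close> \<open>\<not> odd g\<close> w' q less.prems by simp
    qed
  qed
qed

text \<open>A common neighbour of \<open>u\<close> and \<open>v\<close> beyond position 0 would form
  a C4 with \<open>a\<close>; position 0 is special because \<open>a\<close> sees it as well. If
  \<open>v\<close> had a neighbour beyond position 0, then the last alternation between neighbours
  of \<open>u\<close> and of \<open>v\<close> would sit at an even position when measured from the
  end of the path, but at an odd one by \<open>alternation_odd\<close>.\<close>

lemma two_centres:
  assumes h: "hole a b xs"
    and u: "u \<notin> set xs" "E u a" "E u b" and v: "v \<notin> set xs" "E v a" "E v b"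
    and uv: "u \<noteq> v" "\<not> E u v" and hd: "\<not> E u (hd xs)"
    and ux: "x \<in> set xs" "E u x" and vy: "y \<in> set xs" "E v y"
  shows "\<forall>x\<in>set xs. E u x \<longleftrightarrow> x = last xs" "\<forall>x\<in>set xs. E v x \<longleftrightarrow> x = hd xs"
proof -
  define n where "n = length xs - 1"
  have n: "length xs = Suc n" "1 \<le> n" "odd n"
    using hole_length[OF h] even_hole[OF h] by (auto simp: n_def)
  note p = hole_ipath[OF h]
  have adj: "E (xs ! k) (xs ! l) \<longleftrightarrow> k = Suc l \<or> l = Suc k" if "k \<le> n" "l \<le> n" for k l
    using hole_nth[OF h] that n by simp
  have eq: "xs ! k = xs ! l \<longleftrightarrow> k = l" if "k \<le> n" "l \<le> n" for k l
    using hole_nth_eq[OF h] that n by simp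
  have left: "E a (xs ! k) \<longleftrightarrow> k = 0" and right: "E b (xs ! k) \<longleftrightarrow> k = n" if "k \<le> n" for k
    using hole_left[OF h, of k] hole_right[OF h, of k] that n by auto
  have nin: "xs ! k \<noteq> a" "xs ! k \<noteq> b" "xs ! k \<noteq> u" "xs ! k \<noteq> v" if "k \<le> n" for k
    using hole_notin[OF h] u v that n nth_mem[of k xs] by auto
  have hd0: "hd xs = xs ! 0" and last: "last xs = xs ! n"
    using n hd_conv_nth[of xs] last_conv_nth[of xs] by force+
  have vu: "\<not> E v u" using uv sym by blast
  define z where "z = (\<lambda>s. if s then u else v)"
  define M where "M = (\<lambda>s k. E (z s) (xs ! k))"
  have z: "E (z s) a" "E (z s) b" "E a (z s)" "E b (z s)" "\<not> E (z s) (z (\<not> s))" "z s \<noteq> z (\<not> s)" for s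
    using u v uv sym[OF u(2)] sym[OF u(3)] sym[OF v(2)] sym[OF v(3)] vu by (auto simp: z_def)
  have zn: "xs ! k \<noteq> z s" if "k \<le> n" for k s
    using nin[OF that] by (simp add: z_def)
  have disj: "\<not> M (\<not> s) k" if "1 \<le> k" "k \<le> n" "M s k" for s k
  proof
    assume "M (\<not> s) k"
    then have "E (xs ! k) (z (\<not> s))" using sym by (simp add: M_def)
    moreover have "E (z s) (xs ! k)" "\<not> E a (xs ! k)" "a \<noteq> xs ! k"
      using that left[of k] nin(1)[of k] by (auto simp: M_def)
    ultimately show False
      using C4_free[of a "z s" "xs ! k" "z (\<not> s)"] z[of s] z(1)[of "\<not> s"] by simp
  qed
  have first_odd: "odd i" if "M s i" "1 \<le> i" "i \<le> n" "\<And>k. k < i \<Longrightarrow> \<not> M s k" for s i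
  proof -
    have "even (Suc i - 0)"
    proof (rule even_seg[OF p, of 0 i a "z s"])
      fix k assume k: "0 \<le> k" "k \<le> i"
      then have "M s k \<longleftrightarrow> k = i" using that by (metis le_neq_implies_less)
      then show "xs ! k \<noteq> z s \<and> (E (z s) (xs ! k) \<longleftrightarrow> k = i)"
        using zn[of k s] k that by (auto simp: M_def)
      show "xs ! k \<noteq> a \<and> (E a (xs ! k) \<longleftrightarrow> k = 0)" using nin left k that by auto
    qed (use that n z in auto)
    then show ?thesis by simp
  qed
  have last_even: "even l" if "M s l" "l < n" "\<And>k. l < k \<Longrightarrow> k \<le> n \<Longrightarrow> \<not> M s k" for s l
  proof -
    have "even (Suc n - l)"
    proof (rule even_seg[OF p, of l n "z s" b])
      fix k assume k: "l \<le> k" "k \<le> n"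
      then have "M s k \<longleftrightarrow> k = l" using that by (metis le_neq_implies_less)
      then show "xs ! k \<noteq> z s \<and> (E (z s) (xs ! k) \<longleftrightarrow> k = l)"
        using zn[of k s] k that by (auto simp: M_def)
      show "xs ! k \<noteq> b \<and> (E b (xs ! k) \<longleftrightarrow> k = n)" using nin right k that by auto
    qed (use that n z in auto)
    then show ?thesis using n that by simp
  qed
  have sector: "even (g - q)"
    if "M s q" "M s g" "1 \<le> q" "q + 2 \<le> g" "g \<le> n" "\<And>k. q < k \<Longrightarrow> k < g \<Longrightarrow> \<not> M s k" for s q g
  proof -
    \<comment> \<open>The closing edge joins \<open>z s\<close> to \<open>xs ! g\<close>, so the
      segment stops one position earlier; \<open>q + 2 \<le> g\<close> excludes a triangle.\<close>
    have "even (Suc (g - 1) - q)"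
    proof (rule even_seg[OF p, of q "g - 1" "z s" "xs ! g"])
      fix k assume k: "q \<le> k" "k \<le> g - 1"
      then have "M s k \<longleftrightarrow> k = q" using that(1,4) that(6)[of k] by (cases "k = q") auto
      then show "xs ! k \<noteq> z s \<and> (E (z s) (xs ! k) \<longleftrightarrow> k = q)"
        using zn[of k s] k that by (auto simp: M_def)
      show "xs ! k \<noteq> xs ! g \<and> (E (xs ! g) (xs ! k) \<longleftrightarrow> k = g - 1)"
        using adj[of g k] eq[of k g] k that by auto
    qed (use that n in \<open>auto simp: M_def\<close>)
    then show ?thesis using that by simp
  qed
  \<comment> \<open>The cycle is closed through \<open>a\<close>, whose only neighbour on the path
    is at position 0; hence the bound \<open>1 \<le> w\<close>.\<close>
  have cross: "even (g - w)"
    if "M s w" "M (\<not> s) g" "1 \<le> w" "w < g" "g \<le> n"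
      "\<And>k. w < k \<Longrightarrow> k < g \<Longrightarrow> \<not> M s k \<and> \<not> M (\<not> s) k" for s w g
  proof (rule even_seg_snoc[OF p, of w g "z s" a "z (\<not> s)"])
    fix k assume k: "w \<le> k" "k \<le> g"
    have "M s k \<longleftrightarrow> k = w" "M (\<not> s) k \<longleftrightarrow> k = g"
      using that(1-5) k that(6)[of k] disj[of g "\<not> s"] disj[of w s]
      by (cases "k = w"; cases "k = g"; simp)+
    then show "xs ! k \<noteq> z s \<and> (E (z s) (xs ! k) \<longleftrightarrow> k = w)"
      "xs ! k \<noteq> z (\<not> s) \<and> (E (z (\<not> s)) (xs ! k) \<longleftrightarrow> k = g)"
      using zn[of k] k that by (auto simp: M_def)
    show "xs ! k \<noteq> a \<and> \<not> E a (xs ! k)" using nin left k that by auto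
  qed (use that n z[of s] z[of "\<not> s"] in auto)
  have u0: "\<not> M True 0" using hd by (simp add: M_def z_def hd0)
  obtain k0 l0 where k0: "k0 \<le> n" "M True k0" and l0: "l0 \<le> n" "M False l0"
    using ux vy n by (auto simp: in_set_conv_nth M_def z_def less_Suc_eq_le)
  define i where "i = (LEAST k. M True k)"
  have i1: "M True i" unfolding i_def using k0(2) by (rule LeastI)
  have "i \<le> k0" unfolding i_def using k0(2) by (rule Least_le)
  then have i2: "i \<le> n" using k0(1) by simp
  have i3: "\<not> M True k" if "k < i" for k using that not_less_Least unfolding i_def by blast
  have i4: "1 \<le> i" using i1 u0 by (cases i) auto
  note i = i1 i2 i3 i4
  have iodd: "odd i" using first_odd[of True i] i by simp
  text \<open>Otherwise the path up to position \<open>i\<close>, \<open>u\<close>, \<open>b\<close> and \<open>v\<close> form an odd hole.\<close>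
  have early: "\<exists>k. 1 \<le> k \<and> k \<le> i \<and> M False k" if "M False 0" "i < n"
  proof (rule ccontr)
    assume no: "\<not> ?thesis"
    have "even (i - 0)"
    proof (rule even_seg_snoc[OF p, of 0 i v b u])
      fix k assume k: "0 \<le> k" "k \<le> i"
      have "M False k \<longleftrightarrow> k = 0"
      proof (cases "k = 0")
        case True
        then show ?thesis using that(1) by simp
      next
        case False
        then have "1 \<le> k" by simp
        then show ?thesis using no k False by blast
      qed
      moreover have "M True k \<longleftrightarrow> k = i" using i1 i3[of k] k by (cases "k = i") auto
      ultimately show "xs ! k \<noteq> v \<and> (E v (xs ! k) \<longleftrightarrow> k = 0)" "xs ! k \<noteq> u \<and> (E u (xs ! k) \<longleftrightarrow> k = i)"
        using nin[of k] k i2 by (auto simp: M_def z_def)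
      show "xs ! k \<noteq> b \<and> \<not> E b (xs ! k)" using nin(2)[of k] right[of k] k that by auto
    qed (use i2 n uv u v sym[OF u(3)] vu in auto)
    then show False using iodd by simp
  qed
  have first: "odd g"
    if "M s g" "g \<le> n" "\<And>k. 1 \<le> k \<Longrightarrow> k < g \<Longrightarrow> \<not> M s k" "M (\<not> s) w" "1 \<le> w" "w < g" for s w g
  proof (cases "M s 0")
    case False
    then have "\<not> M s k" if "k < g" for k using \<open>\<And>k. 1 \<le> k \<Longrightarrow> k < g \<Longrightarrow> \<not> M s k\<close>[of k] that
      by (cases "k = 0") auto
    then show ?thesis using first_odd[of s g] that by simp
  next
    \<comment> \<open>Only \<open>v\<close> can see position 0. Then \<open>w\<close> is not before
      \<open>i\<close>, and \<open>early\<close> yields a neighbour of \<open>v\<close> between 1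
      and \<open>i\<close>, contrary to \<open>g\<close> being the first one.\<close>
    case True
    then have s: "\<not> s" using u0 by auto
    then have "i \<le> w" using that(4) i(3)[of w] by (simp add: not_less[symmetric]) blast
    then show ?thesis using early True s that by force
  qed
  have no_late: "\<not> M False k" if "1 \<le> k" "k \<le> n" for k
  proof
    assume k: "M False k"
    define lst where "lst = (\<lambda>s. Max {k. k \<le> n \<and> M s k})"
    have fin: "finite {k. k \<le> n \<and> M s k}" for s by simp
    have lst: "lst s \<le> n \<and> M s (lst s)" for s
    proof -
      have "{k. k \<le> n \<and> M s k} \<noteq> {}" using k0 l0 by (cases s) auto
      from Max_in[OF fin this] show ?thesis by (simp add: lst_def)
    qed
    have ge: "k \<le> lst s" if "M s k" "k \<le> n" for s k
      using that by (simp add: lst_def)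
    have pos: "1 \<le> lst s" for s
      using ge[OF i1 i2] i4 ge[OF k that(2)] that(1) by (cases s) simp_all
    have "lst True \<noteq> lst False"
      using disj[of "lst True" True, OF pos] lst[of True] lst[of False] by fastforce
    then consider "lst True < lst (\<not> True)" | "lst False < lst (\<not> False)" by fastforce
    then obtain s where s: "lst s < lst (\<not> s)" by cases blast+
    \<comment> \<open>\<open>s\<close> marks the vertex whose last neighbour \<open>w\<close> comes
      earlier on the path, and \<open>g\<close> is the next neighbour of the other vertex. Being
      last, \<open>w\<close> is even, and so \<open>g\<close> would be even as well as odd.\<close>
    define w where "w = lst s"
    define g where "g = (LEAST k. w < k \<and> M (\<not> s) k)"
    have g: "w < g" "M (\<not> s) g" "g \<le> lst (\<not> s)"
      using LeastI[of "\<lambda>k. w < k \<and> M (\<not> s) k" "lst (\<not> s)"]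
        Least_le[of "\<lambda>k. w < k \<and> M (\<not> s) k" "lst (\<not> s)"] s lst[of "\<not> s"]
      unfolding g_def[symmetric] w_def[symmetric] by blast+
    have gap: "\<not> M s k \<and> \<not> M (\<not> s) k" if "w < k" "k < g" for k
    proof
      show "\<not> M s k" using ge[of s k] that g(3) lst[of "\<not> s"] unfolding w_def by linarith
      show "\<not> M (\<not> s) k"
        using not_less_Least[of k "\<lambda>k. w < k \<and> M (\<not> s) k"] that unfolding g_def by blast
    qed
    have gn: "g \<le> n" and wn: "w < n" using g lst[of "\<not> s"] by auto
    have w: "1 \<le> w" "M s w" using pos lst by (auto simp: w_def)
    have "even w"
    proof (rule last_even[OF w(2) wn])
      show "\<not> M s k" if "w < k" "k \<le> n" for k using ge[of s k] that unfolding w_def by linarith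
    qed
    moreover have "even (g - w)" by (rule cross[OF w(2) g(2) w(1) g(1) gn gap])
    moreover have "odd g"
      by (rule alternation_odd[of M n, OF sector cross disj first w(2) g(2) w(1) g(1) gn gap])
    ultimately show False using g(1) by simp
  qed
  have v0: "M False 0" using l0 no_late[of l0] by (cases "l0 = 0") auto
  have "i = n"
  proof (rule ccontr)
    assume "i \<noteq> n"
    then obtain k where "1 \<le> k" "k \<le> i" "M False k" using early[OF v0] i2 by auto
    then show False using no_late[of k] i2 by simp
  qed
  then show "\<forall>x\<in>set xs. E u x \<longleftrightarrow> x = last xs"
    using i(1,3) eq n by (auto simp: in_set_conv_nth last M_def z_def less_Suc_eq)
  show "\<forall>x\<in>set xs. E v x \<longleftrightarrow> x = hd xs"
  proof
    fix x assume "x \<in> set xs"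
    then obtain k where k: "k \<le> n" "x = xs ! k" using n by (auto simp: in_set_conv_nth less_Suc_eq_le)
    then show "E v x \<longleftrightarrow> x = hd xs"
      using v0 no_late[of k] eq[of k 0] by (cases "k = 0") (auto simp: M_def z_def hd0)
  qed
qed

end

section \<open>Perfect graphs have no odd holes\<close>

lemma (in simple_graph) hole_triangle_free:
  assumes h: "hole u v xs" and S: "{x, y, z} \<subseteq> insert u (insert v (set xs))"
    and E: "E x y" "E y z" "E x z"
  shows False
proof -
  have hl: "hd xs \<noteq> last xs"
    using hole_length[OF h] hole_nth_eq[OF h, of 0 "length xs - 1"] hole_not_Nil[OF h]
    by (simp add: hd_conv_nth last_conv_nth)
  have u: "E u x \<longleftrightarrow> x = hd xs" and v: "E v x \<longleftrightarrow> x = last xs" if "x \<in> set xs" for x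
    using h that by (auto simp: hole_def)
  have path: False if xyz: "x \<in> set xs" "y \<in> set xs" "z \<in> set xs" "E x y" "E y z" "E x z" for x y z
  proof -
    obtain i j k where "i < length xs" "j < length xs" "k < length xs" "x = xs ! i" "y = xs ! j" "z = xs ! k"
      using xyz by (metis in_set_conv_nth)
    then show False using xyz hole_nth[OF h, of i j] hole_nth[OF h, of j k] hole_nth[OF h, of i k] by auto
  qed
  have tri: False
    if "x \<in> {u, v}" "y \<in> insert u (insert v (set xs))" "z \<in> insert u (insert v (set xs))"
      "E x y" "E y z" "E x z" for x y z
    using that u v hl irrefl sym_iff[of y x] sym_iff[of z x] sym_iff[of z y] sym_iff[of y u]
      sym_iff[of y v] sym_iff[of z u] sym_iff[of z v]
    by (elim insertE emptyE) auto
  have "x \<in> {u, v} \<or> y \<in> {u, v} \<or> z \<in> {u, v} \<or> (x \<in> set xs \<and> y \<in> set xs \<and> z \<in> set xs)"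
    using S by auto
  then show False
  proof (elim disjE)
    assume "x \<in> {u, v}" then show False using tri[of x y z] S E by simp
  next
    assume "y \<in> {u, v}" then show False using tri[of y x z] S E sym[OF E(1)] by simp
  next
    assume "z \<in> {u, v}" then show False using tri[of z x y] S E sym[OF E(2)] sym[OF E(3)] by simp
  qed (use path[of x y z] E in simp)
qed

text \<open>Two colours alternate along \<open>xs\<close>, so for odd length both ends have the same
  colour, and the adjacent vertices \<open>u\<close> and \<open>v\<close> are both left with the
  other one.\<close>

lemma (in simple_graph) hole_not_two_colourable:
  assumes h: "hole u v xs" and odd: "odd (length xs)"
    and c: "proper_colouring E (insert u (insert v (set xs))) k c" and k: "k \<le> 2"
  shows False
proof -
  have lt: "c x < 2" if "x \<in> insert u (insert v (set xs))" for x
    using c k that unfolding proper_colouring_def by (metis order_less_le_trans)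
  have flip: "even (c x) \<longleftrightarrow> odd (c y)"
    if "x \<in> insert u (insert v (set xs))" "y \<in> insert u (insert v (set xs))" "E x y" for x y
  proof -
    have "c x \<noteq> c y" using c that unfolding proper_colouring_def by blast
    then show ?thesis using lt[OF that(1)] lt[OF that(2)] by (auto simp: less_2_cases_iff)
  qed
  have alt: "even (c (xs ! i)) \<longleftrightarrow> (even (c (xs ! 0)) \<longleftrightarrow> even i)" if "i < length xs" for i
    using that
  proof (induction i)
    case (Suc i)
    then show ?case using flip[of "xs ! i" "xs ! Suc i"] hole_nth[OF h, of i "Suc i"] by auto
  qed simp
  let ?n = "length xs - 1"
  have n: "?n < length xs" "even ?n" "0 < length xs" "Suc ?n = length xs"
    using hole_length[OF h] odd by auto
  have "E u (xs ! 0)" "E v (xs ! ?n)" using hole_left[OF h n(3)] hole_right[OF h n(1)] n by auto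
  then show False
    using alt[OF n(1)] flip[of u "xs ! 0"] flip[of v "xs ! ?n"] flip[of u v] hole_edge[OF h] n by auto
qed

text \<open>An odd cycle longer than a triangle has clique number at most 2 but no colouring with
  two colours.\<close>

lemma (in simple_graph) perfect_even_hole:
  assumes perf: "perfect V E" and V: "\<And>x y. E x y \<Longrightarrow> x \<in> V" and h: "hole u v xs"
  shows "even (length xs)"
proof (rule ccontr)
  assume odd: "odd (length xs)"
  define S where "S = insert u (insert v (set xs))"
  have fin: "finite S" by (simp add: S_def)
  have "x \<in> V" if "x \<in> set xs" for x
  proof -
    obtain i where i: "i < length xs" "x = xs ! i" using \<open>x \<in> set xs\<close> by (auto simp: in_set_conv_nth)
    \<comment> \<open>Each vertex of the path has a neighbour on the path, and ends of edges lie in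
      \<open>V\<close>.\<close>
    have "Suc i < length xs \<or> (i > 0 \<and> i - 1 < length xs)" using i hole_length[OF h] by auto
    then show ?thesis
      using i hole_nth[OF h, of i "Suc i"] hole_nth[OF h, of i "i - 1"] V by fastforce
  qed
  then have SV: "S \<subseteq> V" using V hole_edge[OF h] sym[OF hole_edge[OF h]] by (auto simp: S_def)
  have small: "card K \<le> 2" if K: "K \<subseteq> S" "clique E K" for K
  proof (rule ccontr)
    assume "\<not> card K \<le> 2"
    then obtain T where T: "T \<subseteq> K" "card T = 3" by (metis not_less_eq_eq numeral_2_eq_2 numeral_3_eq_3 obtain_subset_with_card_n)
    then obtain x y z where xyz: "T = {x, y, z}" "x \<noteq> y" "y \<noteq> z" "x \<noteq> z" by (auto simp: card_3_iff)
    then have "E x y" "E y z" "E x z" using K(2) T(1) unfolding clique_def by auto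
    then show False using hole_triangle_free[OF h, of x y z] K(1) T(1) xyz(1) by (auto simp: S_def)
  qed
  have "finite {card K | K. K \<subseteq> S \<and> clique E K}"
    using fin by (rule_tac finite_subset[of _ "card ` Pow S"]) auto
  moreover have "card {} \<in> {card K | K. K \<subseteq> S \<and> clique E K}"
    by (intro CollectI exI[of _ "{}"]) (simp add: clique_def)
  ultimately have "clique_number E S \<le> 2"
    unfolding clique_number_def using small by (subst Max_le_iff) auto
  then have "chromatic_number E S \<le> 2" using perf SV by (auto simp: perfect_def)
  \<comment> \<open>\<open>chromatic_number\<close> is a \<open>LEAST\<close>, so it is attained
    only once some colouring is known to exist; numbering the vertices gives one.\<close>
  moreover have "\<exists>c. proper_colouring E S (card S) c"
  proof -
    obtain c where "bij_betw c S {0..<card S}" using ex_bij_betw_finite_nat[OF fin] by blast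
    then show ?thesis
      using irrefl unfolding proper_colouring_def bij_betw_def inj_on_def by (intro exI[of _ c]) force
  qed
  then have "\<exists>c. proper_colouring E S (chromatic_number E S) c"
    unfolding chromatic_number_def by (rule LeastI)
  ultimately show False using hole_not_two_colourable[OF h odd] by (auto simp: S_def)
qed

context prism_free_graph
begin

section \<open>Linked pairs of vertices with a common attachment\<close>

lemma shortest_path_between:
  assumes "conn W" "w \<in> W" "E y w" "w' \<in> W" "E x w'"
  obtains ys where "ipath ys" "set ys \<subseteq> W"
    "\<And>v. v \<in> set ys \<Longrightarrow> E y v \<longleftrightarrow> v = hd ys"
    "\<And>v. v \<in> set ys \<Longrightarrow> E x v \<longleftrightarrow> v = last ys"
proof (rule shortest_path[OF assms(1,2) singletonI assms(3,4) singletonI sym[OF assms(5)]])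
  fix ys
  assume ys: "ipath ys" "set ys \<subseteq> W"
    and y: "\<And>v. v \<in> set ys \<Longrightarrow> (\<exists>y\<in>{y}. E y v) \<longleftrightarrow> v = hd ys"
    and x: "\<And>v. v \<in> set ys \<Longrightarrow> (\<exists>x\<in>{x}. E v x) \<longleftrightarrow> v = last ys"
  show thesis
    by (rule that[OF ys]) (use x y sym_iff[of x] in auto)
qed

text \<open>\<open>a\<close>, \<open>S\<close>, \<open>p\<close>, \<open>b1\<close> form an induced
  cycle in which \<open>b2\<close> can replace \<open>b1\<close>. Conversely \<open>a\<close> and
  \<open>p\<close> are nonadjacent and complete to the edge \<open>b1 b2\<close>, which is the
  setting of \<open>two_centres\<close>.\<close>

definition twin :: "'a \<Rightarrow> 'a \<Rightarrow> 'a \<Rightarrow> 'a \<Rightarrow> 'a list \<Rightarrow> bool" where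
  "twin a p b1 b2 S \<longleftrightarrow> ipath S \<and> E a b1 \<and> E a b2 \<and> E p b1 \<and> E p b2 \<and> E b1 b2
    \<and> \<not> E a p \<and> a \<noteq> p \<and> a \<notin> set S \<and> p \<notin> set S
    \<and> (\<forall>x\<in>set S. (E a x \<longleftrightarrow> x = hd S) \<and> (E p x \<longleftrightarrow> x = last S)
        \<and> x \<noteq> b1 \<and> \<not> E b1 x \<and> x \<noteq> b2 \<and> \<not> E b2 x)"

text \<open>An induced path from \<open>b1\<close> to \<open>S\<close> off the closed neighbourhood
  of \<open>b2\<close>, listed without \<open>b1\<close> and without the vertex reached on
  \<open>S\<close>.\<close>

definition arm :: "'a \<Rightarrow> 'a \<Rightarrow> 'a list \<Rightarrow> 'a list \<Rightarrow> bool" where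
  "arm b1 b2 S rs \<longleftrightarrow> ipath rs \<and> (\<forall>y\<in>set rs. y \<notin> set S \<and> y \<noteq> b2 \<and> \<not> E b2 y
    \<and> y \<noteq> b1 \<and> (E b1 y \<longleftrightarrow> y = hd rs) \<and> ((\<exists>x\<in>set S. E y x) \<longleftrightarrow> y = last rs))"

text \<open>\<open>b1\<close> and \<open>b2\<close> are exchanged along with \<open>a\<close> and
  \<open>p\<close>, to match the reversal of a hole through the edge \<open>b1 b2\<close>.\<close>

lemma twin_reverse: "twin a p b1 b2 S \<Longrightarrow> twin p a b2 b1 (rev S)"
  by (auto simp: twin_def hd_rev last_rev sym sym_iff[of p a])

lemma twin_swap: "twin a p b1 b2 S \<Longrightarrow> twin a p b2 b1 S"
  by (auto simp: twin_def sym)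

lemma arm_reverse: "arm b1 b2 S rs \<Longrightarrow> arm b1 b2 (rev S) rs"
  by (simp add: arm_def)

lemma arm_not_Nil: "arm b1 b2 S rs \<Longrightarrow> rs \<noteq> []"
  using ipath_not_Nil by (auto simp: arm_def)

text \<open>The last two assumptions are an outcome of \<open>two_centres\<close>. If
  \<open>r = hd rs\<close> missed \<open>S\<close>, then \<open>a\<close> would form a triangle with
  the edge \<open>r b1\<close> of the hole \<open>r\<close>, \<open>tl ys\<close>, \<open>p\<close>,
  \<open>b1\<close>, and \<open>S\<close> would link \<open>a\<close> to \<open>p\<close>. If
  \<open>r\<close> saw \<open>S\<close> beyond \<open>hd S\<close>, the part of \<open>S\<close>
  from its last neighbour on would close two cycles of different parity, one through
  \<open>p\<close>, \<open>b1\<close> and one through \<open>p\<close>, \<open>b2\<close>,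
  \<open>a\<close>.\<close>

lemma short_arm:
  assumes tw: "twin a p b1 b2 S" and arm: "arm b1 b2 S rs"
    and ys: "hole b1 b2 ys" "hd ys = hd rs" "a \<notin> set ys" "p \<notin> set ys"
    and ay: "\<And>y. y \<in> set ys \<Longrightarrow> E a y \<longleftrightarrow> y = hd ys"
    and py: "\<And>y. y \<in> set ys \<Longrightarrow> E p y \<longleftrightarrow> y = last ys"
  shows "rs = [hd rs]" "\<And>x. x \<in> set S \<Longrightarrow> E (hd rs) x \<Longrightarrow> x = hd S"
proof -
  define r where "r = hd rs"
  have S: "ipath S" "S \<noteq> []" using tw ipath_not_Nil by (auto simp: twin_def)
  have rs: "r \<in> set rs" "ipath rs" using arm arm_not_Nil[OF arm] by (auto simp: r_def arm_def)
  have edges: "E a b1" "E a b2" "E p b1" "E p b2" "E b1 b2" "\<not> E a p" "a \<noteq> p" "a \<notin> set S" "p \<notin> set S"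
    using tw by (auto simp: twin_def)
  have Sx: "E a x \<longleftrightarrow> x = hd S" "E p x \<longleftrightarrow> x = last S" "x \<noteq> b1" "\<not> E b1 x" "x \<noteq> b2" "\<not> E b2 x"
    if "x \<in> set S" for x using tw that by (auto simp: twin_def)
  have r: "r \<notin> set S" "r \<noteq> b2" "\<not> E b2 r" "r \<noteq> b1" "E b1 r"
    using arm rs by (auto simp: arm_def r_def)
  obtain zs where zs: "ys = r # zs" "zs \<noteq> []"
  proof (rule that)
    show "ys = r # tl ys" "tl ys \<noteq> []"
      using ys(2) hole_length[OF ys(1)] by (cases ys; cases "tl ys"; auto simp: r_def)+
  qed
  have ryp: "E a r" "\<not> E p r"
    using ay[of r] py[of r] zs ipath_distinct[OF hole_ipath[OF ys(1)]] by auto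
  then have rp: "\<not> E r p" using sym by blast
  have "a \<noteq> r" "p \<noteq> r" using ys zs by auto
  have at: "\<exists>x\<in>set S. E r x"
  proof (rule ccontr)
    assume none: "\<not> ?thesis"
    have zp: "ipath zs" "r \<notin> set zs" "\<And>y. y \<in> set zs \<Longrightarrow> E r y \<longleftrightarrow> y = hd zs"
      using hole_ipath[OF ys(1)] zs by (auto simp: ipath_Cons)
    have lz: "last ys = last zs" using zs by simp
    have "ipath (zs @ [p])"
      using zp zs ys py lz by (intro ipath_append) (auto simp: sym_iff[of _ p])
    moreover have "\<not> E b1 y" "y \<noteq> b1" if "y \<in> set zs" for y
      using ys(1) that zs zp by (auto simp: hole_def)
    moreover have "p \<noteq> b1" "p \<notin> set zs" using edges(3) irrefl[of b1] ys(4) zs by auto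
    ultimately have h: "hole r b1 (zs @ [p])"
      unfolding hole_def using zs zp r rp sym[OF edges(3)] sym[OF r(5)] \<open>p \<noteq> r\<close>
      by (cases zs) auto
    have az: "\<not> E a y" if "y \<in> set zs" for y using ay[of y] that zs zp by auto
    have "E (last S) p" using Sx(2)[of "last S"] S(2) sym by simp
    moreover have "w \<noteq> r \<and> \<not> E r w" if "w \<in> set S" for w using none r(1) that by blast
    ultimately show False
      using no_link[OF h _ ryp(1) edges(1) _ conn_ipath[OF S(1)], of "hd S" "last S" p]
        az edges ys(3) zs S(2) Sx by auto
  qed
  then have "r = last rs" using arm rs by (auto simp: arm_def)
  then show single: "rs = [hd rs]"
    using ipath_distinct[OF rs(2)] arm_not_Nil[OF arm] by (cases rs) (auto simp: r_def split: if_splits)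
  fix x assume x: "x \<in> set S" "E (hd rs) x"
  show "x = hd S"
  proof (rule ccontr)
    assume "x \<noteq> hd S"
    define n where "n = length S"
    have n: "0 < n" using S by (simp add: n_def)
    define L where "L = S @ [p]"
    have L: "ipath L" "length L = Suc n"
      unfolding L_def using S Sx edges
      by (intro ipath_append) (auto simp: sym_iff[of _ p] n_def)
    have Lk: "L ! k = S ! k" "S ! k \<in> set S" if "k < n" for k using that by (auto simp: L_def n_def nth_append)
    have Ln: "L ! n = p" by (simp add: L_def n_def)
    have hdS: "hd S = S ! 0" using S by (simp add: hd_conv_nth)
    obtain k0 where k0: "k0 < n" "x = S ! k0" using x by (auto simp: in_set_conv_nth n_def)
    define K where "K = {k. k < n \<and> E r (S ! k)}"
    have K: "finite K" "k0 \<in> K" using k0 x by (auto simp: K_def r_def)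
    define e where "e = Max K"
    have "e \<in> K" using Max_in[OF K(1)] K(2) by (auto simp: e_def)
    then have e: "e < n" "E r (S ! e)" by (auto simp: K_def)
    have "k0 \<noteq> 0" using k0 \<open>x \<noteq> hd S\<close> hdS by (cases "k0 = 0") auto
    \<comment> \<open>Position 0 has to be avoided because \<open>a\<close> lies on the second cycle
      and sees \<open>hd S\<close>.\<close>
    then have e1: "1 \<le> e" using Max_ge[OF K] by (simp add: e_def)
    have max: "\<not> E r (S ! k)" if "e < k" "k < n" for k
    proof -
      have "k \<notin> K" using Max_ge[OF K(1), of k] that(1) by (auto simp: e_def)
      then show ?thesis using that(2) by (simp add: K_def)
    qed
    have rL: "L ! k \<noteq> r \<and> (E r (L ! k) \<longleftrightarrow> k = e)" if "e \<le> k" "k \<le> n" for k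
    proof (cases "k = n")
      case True
      then show ?thesis using Ln rp \<open>p \<noteq> r\<close> e by auto
    next
      case False
      then show ?thesis using Lk[of k] that max[of k] e r by (cases "k = e") auto
    qed
    have "even (Suc n - e)"
    proof (rule even_seg[OF L(1) e(1) _ sym[OF r(5)] rL])
      show "L ! k \<noteq> b1 \<and> (E b1 (L ! k) \<longleftrightarrow> k = n)" if "e \<le> k" "k \<le> n" for k
        using that Lk[of k] Sx[of "S ! k"] Ln sym[OF edges(3)] irrefl[of b1] by (cases "k = n") auto
    qed (use L in auto)
    moreover have "even (n - e)"
    proof (rule even_seg_snoc[OF L(1) _ _ sym[OF ryp(1)] edges(2) _ r(2) rL])
      fix k assume k: "e \<le> k" "k \<le> n"
      have "S ! k \<noteq> hd S" if "k < n"
        using that k e1 ipath_distinct[OF S(1)] S(2) by (simp add: hdS nth_eq_iff_index_eq n_def)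
      then show "L ! k \<noteq> a \<and> \<not> E a (L ! k)"
        using k Lk[of k] Sx[of "S ! k"] Ln edges by (cases "k = n") auto
      show "L ! k \<noteq> b2 \<and> (E b2 (L ! k) \<longleftrightarrow> k = n)"
        using k Lk[of k] Sx[of "S ! k"] Ln sym[OF edges(4)] irrefl[of b2] by (cases "k = n") auto
    next
      show "\<not> E r b2" using r(3) sym by blast
    qed (use L e in auto)
    ultimately show False using e by (simp add: Suc_diff_le)
  qed
qed

text \<open>Both arms are single vertices \<open>r\<close> and \<open>s\<close>. The vertex after
  \<open>r\<close> on \<open>ys\<close> is not on \<open>S\<close>, where \<open>r\<close> sees only
  \<open>hd S\<close>, a neighbour of \<open>a\<close>. So it is \<open>s\<close>, and
  \<open>b1 r s b2\<close> is a C4.\<close>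

lemma twin_arms_short:
  assumes tw: "twin a p b1 b2 S" and arms: "arm b1 b2 S rs" "arm b2 b1 S ss"
    and ys: "hole b1 b2 ys" "hd ys = hd rs" "last ys = hd ss" "set ys \<subseteq> set rs \<union> set S \<union> set ss"
    and ap: "a \<notin> set ys" "p \<notin> set ys"
    and ay: "\<And>y. y \<in> set ys \<Longrightarrow> E a y \<longleftrightarrow> y = hd ys"
    and py: "\<And>y. y \<in> set ys \<Longrightarrow> E p y \<longleftrightarrow> y = last ys"
  shows False
proof -
  define r s where "r = hd rs" and "s = hd ss"
  have rs: "rs = [r]" and rS: "\<And>x. x \<in> set S \<Longrightarrow> E r x \<Longrightarrow> x = hd S"
    using short_arm[OF tw arms(1) ys(1,2) ap ay py] by (auto simp: r_def)
  have ss: "ss = [s]"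
    using short_arm(1)[OF twin_reverse[OF tw] arm_reverse[OF arms(2)] hole_rev[OF ys(1)]] ys(3) ap ay py
    by (auto simp: s_def hd_rev last_rev)
  obtain zs where zs: "ys = r # zs" "zs \<noteq> []"
  proof (rule that)
    show "ys = r # tl ys" "tl ys \<noteq> []"
      using ys(2) hole_length[OF ys(1)] by (cases ys; cases "tl ys"; auto simp: r_def)+
  qed
  have d: "r \<notin> set zs" "E r (hd zs)" using hole_ipath[OF ys(1)] zs by (auto simp: ipath_Cons)
  have hz: "hd zs \<in> set ys" "hd zs \<noteq> r" using zs d hd_in_set[OF zs(2)] by auto
  have "hd zs \<notin> set S"
  proof
    assume "hd zs \<in> set S"
    then have "E a (hd zs)" using rS d(2) tw by (auto simp: twin_def)
    then show False using ay[OF hz(1)] hz zs by auto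
  qed
  then have "hd zs = s" using hz ys(4) rs ss by auto
  then have "E r s" using d by simp
  moreover have "E b1 r" "E b2 s" "\<not> E b2 r" "\<not> E b1 s" "r \<noteq> b2" "s \<noteq> b1"
    using arms rs ss by (auto simp: arm_def)
  moreover have "E b1 b2" using tw by (auto simp: twin_def)
  ultimately show False using C4_free[of b1 r s b2] sym by blast
qed

text \<open>A shortest path through both arms and \<open>S\<close> makes a hole with the edge
  \<open>b1 b2\<close>. Once \<open>a\<close> and \<open>p\<close> are known to see this path,
  \<open>two_centres\<close> places their neighbours at opposite ends of it, which makes the arms
  short.\<close>

lemma no_twin_arms:
  assumes tw: "twin a p b1 b2 S" and arms: "arm b1 b2 S rs" "arm b2 b1 S ss"
    and nin: "a \<notin> set rs \<union> set ss" "p \<notin> set rs \<union> set ss"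
  shows False
proof -
  have S: "ipath S" "S \<noteq> []" using tw ipath_not_Nil by (auto simp: twin_def)
  have edges: "E a b1" "E a b2" "E p b1" "E p b2" "E b1 b2" "\<not> E a p" "a \<noteq> p" "a \<notin> set S" "p \<notin> set S"
    using tw by (auto simp: twin_def)
  have Sx: "E a x \<longleftrightarrow> x = hd S" "E p x \<longleftrightarrow> x = last S" "x \<noteq> b1" "\<not> E b1 x" "x \<noteq> b2" "\<not> E b2 x"
    if "x \<in> set S" for x using tw that by (auto simp: twin_def)
  have rs: "ipath rs" "rs \<noteq> []" and ss: "ipath ss" "ss \<noteq> []"
    using arms arm_not_Nil by (auto simp: arm_def)
  have ry: "y \<notin> set S" "y \<noteq> b2" "\<not> E b2 y" "y \<noteq> b1" "E b1 y \<longleftrightarrow> y = hd rs"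
    if "y \<in> set rs" for y using arms that by (auto simp: arm_def)
  have sy: "y \<notin> set S" "y \<noteq> b1" "\<not> E b1 y" "y \<noteq> b2" "E b2 y \<longleftrightarrow> y = hd ss"
    if "y \<in> set ss" for y using arms that by (auto simp: arm_def)
  obtain x where x: "x \<in> set S" "E (last rs) x"
    using arms(1) last_in_set[OF rs(2)] unfolding arm_def by blast
  obtain x' where x': "x' \<in> set S" "E x' (last ss)"
    using arms(2) last_in_set[OF ss(2)] sym unfolding arm_def by blast
  let ?W = "set rs \<union> set S \<union> set ss"
  have "conn (set rs \<union> set S)"
    using conn_Un[OF conn_ipath[OF rs(1)] conn_ipath[OF S(1)], of "last rs" x] x rs by simp
  then have "conn ?W"
    using conn_Un[OF _ conn_ipath[OF ss(1)], of "set rs \<union> set S" x' "last ss"] x' ss by simp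
  moreover have "hd rs \<in> ?W" "E b1 (hd rs)" "hd ss \<in> ?W" "E b2 (hd ss)"
    using ry(5)[of "hd rs"] sy(5)[of "hd ss"] rs ss by auto
  ultimately obtain ys where ys: "ipath ys" "set ys \<subseteq> ?W"
    and y1: "\<And>y. y \<in> set ys \<Longrightarrow> E b1 y \<longleftrightarrow> y = hd ys"
    and y2: "\<And>y. y \<in> set ys \<Longrightarrow> E b2 y \<longleftrightarrow> y = last ys"
  proof (rule shortest_path_between)
  qed (use that in blast)
  have ne: "ys \<noteq> []" using ys(1) ipath_not_Nil by blast
  have hy: "hd ys = hd rs"
    using y1[of "hd ys"] ys(2) ne Sx(4) sy(3) ry(5) hd_in_set[OF ne] by blast
  have ly: "last ys = hd ss"
    using y2[of "last ys"] ys(2) ne Sx(6) ry(3) sy(5) last_in_set[OF ne] by blast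
  have "hd rs \<noteq> hd ss" using ry(3)[of "hd rs"] sy(5)[of "hd ss"] rs ss by auto
  then have "2 \<le> length ys" using hy ly ne by (cases ys; cases "tl ys") auto
  moreover have "b1 \<notin> ?W" "b2 \<notin> ?W" using Sx ry sy by blast+
  ultimately have h: "hole b1 b2 ys"
    unfolding hole_def using ys edges y1 y2 by blast
  have ap: "a \<notin> set ys" "p \<notin> set ys" using ys(2) nin edges by blast+
  \<comment> \<open>The connecting set for \<open>no_link\<close>. It leaves out
    \<open>hd rs\<close>, which \<open>b1\<close> sees and which is the vertex of the hole to be
    reached.\<close>
  obtain T w where T: "conn T" "set S \<subseteq> T" "T \<subseteq> set S \<union> (set rs - {hd rs})" "w \<in> T" "E w (hd rs)"
  proof (cases "tl rs = []")
    case True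
    then have "last rs = hd rs" using rs by (cases rs) auto
    then show ?thesis using that[of "set S" x] x conn_ipath[OF S(1)] sym[OF x(2)] by auto
  next
    case False
    then have c: "rs = hd rs # tl rs" "ipath (tl rs)" "E (hd rs) (hd (tl rs))" "hd rs \<notin> set (tl rs)"
      using rs by (cases rs; auto simp: ipath_Cons)+
    then have "conn (set (tl rs) \<union> set S)"
      using conn_Un[OF conn_ipath[OF c(2)] conn_ipath[OF S(1)], of "last rs" x] x False
      by (metis last_ConsR last_in_set)
    moreover have "set (tl rs) \<subseteq> set rs - {hd rs}" using c(1,4) by (metis Diff_insert_absorb Diff_mono list.simps(15) subset_insertI subset_refl)
    ultimately show ?thesis
      using that[of "set (tl rs) \<union> set S" "hd (tl rs)"] hd_in_set[OF False] sym[OF c(3)] by blast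
  qed
  have T': "w \<noteq> b1 \<and> \<not> E b1 w" "w \<noteq> b2 \<and> \<not> E b2 w" "w \<noteq> a" "w \<noteq> p" if "w \<in> T" for w
    using that T(3) Sx(3-6)[of w] ry(2-5)[of w] nin edges by auto
  have mark: "\<exists>y\<in>set ys. E t y" if t: "t \<in> {a, p}" for t
  proof (rule ccontr)
    assume no: "\<not> ?thesis"
    have "\<exists>x\<in>set S. E t x" using t Sx(1)[of "hd S"] Sx(2)[of "last S"] S by auto
    then obtain x where x: "x \<in> T" "E t x" using T(2) by blast
    show False
    proof (rule no_link[OF h _ _ _ _ T(1) _ x T(4) _ T(5)])
      show "t \<notin> T" using T'(3,4) t by blast
      show "hd rs \<in> set ys" using hd_in_set[OF ne] hy by simp
    qed (use t ap edges no T' in auto)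
  qed
  have notboth: "\<not> (E a (hd rs) \<and> E p (hd rs))"
  proof
    assume "E a (hd rs) \<and> E p (hd rs)"
    then show False
      using C4_free[of "hd rs" a b2 p] sym[of a "hd rs"] sym[OF edges(4)] sym[of "hd rs" b2]
        edges ry(2,3)[of "hd rs"] rs(2) by auto
  qed
  obtain x y where xa: "x \<in> set ys" "E a x" and yp: "y \<in> set ys" "E p y" using mark by blast
  show False
  proof (cases "E a (hd rs)")
    case False
    then have "\<not> E a (hd ys)" using hy by simp
    note tc = two_centres[OF h ap(1) edges(1,2) ap(2) edges(3,4,7,6) this xa yp]
    \<comment> \<open>Here it is \<open>p\<close> that sees \<open>hd ys\<close>, so
      \<open>a\<close> and \<open>p\<close> are exchanged while \<open>b1\<close> and
      \<open>b2\<close> keep their places.\<close>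
    show False
      by (intro twin_arms_short[OF twin_swap[OF twin_reverse[OF tw]] arm_reverse[OF arms(1)]
          arm_reverse[OF arms(2)] h hy ly])
        (use tc ys(2) ap in simp_all)
  next
    case True
    have "\<not> E p a" "p \<noteq> a" using edges sym by blast+
    have "\<not> E p (hd ys)" using True notboth hy by simp
    note tc = two_centres[OF h ap(2) edges(3,4) ap(1) edges(1,2) \<open>p \<noteq> a\<close> \<open>\<not> E p a\<close> this yp xa]
    show False
      by (intro twin_arms_short[OF tw arms h hy ly ys(2) ap]) (use tc in simp_all)
  qed
qed

section \<open>Reducing the number of attachments\<close>

text \<open>\<open>hd xs\<close> plays the part of \<open>c\<close>, and \<open>i\<close> is the
  first neighbour of \<open>b2\<close>. The path \<open>rs\<close> leads from the far side, which
  includes \<open>b1\<close>, to the near side and thus past \<open>xs ! i\<close>; its adjacency to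
  \<open>xs ! i\<close> is left free, since the new holes avoid that vertex.\<close>

context
  fixes a b1 b2 xs n i rs
  assumes tri: "E a b1" "E a b2" "E b1 b2"
    and h: "hole a b1 xs" and n: "length xs = Suc n" and b2: "b2 \<notin> set xs"
    and i: "E b2 (xs ! i)" "1 \<le> i" "i < n" and first: "\<And>k. k < i \<Longrightarrow> \<not> E b2 (xs ! k)"
    and rs: "ipath rs"
    and rs_new: "\<And>y. y \<in> set rs \<Longrightarrow> y \<notin> set xs \<and> y \<noteq> b1 \<and> y \<noteq> b2 \<and> \<not> E b2 y"
    and rs_hd: "\<And>y. y \<in> set rs \<Longrightarrow>
      (E y b1 \<or> (\<exists>k. i < k \<and> k \<le> n \<and> E y (xs ! k))) \<longleftrightarrow> y = hd rs"
    and rs_last: "\<And>y. y \<in> set rs \<Longrightarrow> (\<exists>k<i. E y (xs ! k)) \<longleftrightarrow> y = last rs"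
begin

private lemma adj: "k \<le> n \<Longrightarrow> l \<le> n \<Longrightarrow> E (xs ! k) (xs ! l) \<longleftrightarrow> k = Suc l \<or> l = Suc k"
  using hole_nth[OF h] n by simp

private lemma eq: "k \<le> n \<Longrightarrow> l \<le> n \<Longrightarrow> xs ! k = xs ! l \<longleftrightarrow> k = l"
  using hole_nth_eq[OF h] n by simp

private lemma left: "k \<le> n \<Longrightarrow> E a (xs ! k) \<longleftrightarrow> k = 0"
  and right: "k \<le> n \<Longrightarrow> E b1 (xs ! k) \<longleftrightarrow> k = n"
  using hole_left[OF h] hole_right[OF h] n by auto

private lemma nth_in: "k \<le> n \<Longrightarrow> xs ! k \<in> set xs"
  using n by simp

private lemma nin: "k \<le> n \<Longrightarrow> xs ! k \<noteq> a" "k \<le> n \<Longrightarrow> xs ! k \<noteq> b1" "k \<le> n \<Longrightarrow> xs ! k \<noteq> b2"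
    "k \<le> n \<Longrightarrow> xs ! k \<notin> set rs"
  using hole_notin[OF h] b2 nth_in rs_new by blast+

private lemma odd_n: "odd n"
  using even_hole[OF h] n by simp

text \<open>The cycle through \<open>a\<close>, the hole up to \<open>xs ! i\<close>, and
  \<open>b2\<close> is even.\<close>

private lemma odd_i: "odd i"
proof -
  have "even (Suc i - 0)"
  proof (rule even_seg[OF hole_ipath[OF h], of 0 i a b2])
    fix k assume k: "0 \<le> k" "k \<le> i"
    show "xs ! k \<noteq> a \<and> (E a (xs ! k) \<longleftrightarrow> k = 0)" using left nin k i by auto
    show "xs ! k \<noteq> b2 \<and> (E b2 (xs ! k) \<longleftrightarrow> k = i)"
      using first[of k] nin(3)[of k] k i by (cases "k = i") auto
  qed (use i n tri in auto)
  then show ?thesis by simp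
qed

private lemma rs_ne: "rs \<noteq> []"
  using rs ipath_not_Nil by blast

private lemma r_in: "hd rs \<in> set rs" "last rs \<in> set rs"
  using rs_ne by auto

private lemma rs_right: "y \<in> set rs \<Longrightarrow> y \<noteq> hd rs \<Longrightarrow> \<not> E y b1"
    "y \<in> set rs \<Longrightarrow> y \<noteq> hd rs \<Longrightarrow> i < k \<Longrightarrow> k \<le> n \<Longrightarrow> \<not> E y (xs ! k)"
  using rs_hd by blast+

private lemma rs_left: "y \<in> set rs \<Longrightarrow> y \<noteq> last rs \<Longrightarrow> k < i \<Longrightarrow> \<not> E y (xs ! k)"
  using rs_last by blast

private lemma sg: "k \<le> l \<Longrightarrow> l \<le> n \<Longrightarrow> ipath (seg xs k l)"
    "k \<le> l \<Longrightarrow> l \<le> n \<Longrightarrow> hd (seg xs k l) = xs ! k"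
    "k \<le> l \<Longrightarrow> l \<le> n \<Longrightarrow> last (seg xs k l) = xs ! l"
    "k \<le> l \<Longrightarrow> l \<le> n \<Longrightarrow> length (seg xs k l) = Suc l - k"
    "k \<le> l \<Longrightarrow> l \<le> n \<Longrightarrow> seg xs k l \<noteq> []"
    "k \<le> l \<Longrightarrow> l \<le> n \<Longrightarrow> x \<in> set (seg xs k l) \<longleftrightarrow> (\<exists>m. k \<le> m \<and> m \<le> l \<and> x = xs ! m)"
  using ipath_seg[OF hole_ipath[OF h]] hd_seg[of k l xs] last_seg[of k l xs] length_seg[of k l xs]
    seg_not_Nil[of k l xs] in_seg[of k l xs] n by simp_all

private lemma start_conn: "conn {xs ! k | k. k < i}"
proof -
  have "m \<le> i - 1 \<longleftrightarrow> m < i" for m using i by auto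
  then have "set (seg xs 0 (i - 1)) = {xs ! k | k. k < i}"
    using sg(6)[of 0 "i - 1"] i by auto
  then show ?thesis using conn_ipath[OF sg(1)[of 0 "i - 1"]] i by simp
qed

private lemma link_conn: "conn (set rs \<union> {xs ! k | k. k < i})"
proof -
  obtain k where k: "k < i" "E (last rs) (xs ! k)" using rs_last r_in by blast
  then show ?thesis
    using conn_Un[OF conn_ipath[OF rs] start_conn, of "last rs" "xs ! k"] r_in by blast
qed

text \<open>If the path meets the far side of the hole only in \<open>b1\<close>, it closes up with \<open>b2\<close> and with
  the far side to two cycles of different parity.\<close>

private lemma far_neighbour: "\<exists>k. i < k \<and> k \<le> n \<and> E (hd rs) (xs ! k)"
proof (rule ccontr)
  assume none: "\<not> ?thesis"
  then have "E (hd rs) b1" using rs_hd[OF r_in(1)] by blast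
  then have br: "E b1 (hd rs)" by (rule sym)
  let ?W = "set rs \<union> {xs ! k | k. k < i}"
  have W: "xs ! (i - 1) \<in> ?W" "E (xs ! i) (xs ! (i - 1))" "hd rs \<in> ?W"
    using adj[of i "i - 1"] i r_in by auto
  obtain ys where ys: "ipath ys" "set ys \<subseteq> ?W"
    and yb: "\<And>v. v \<in> set ys \<Longrightarrow> E b1 v \<longleftrightarrow> v = hd ys"
    and yi: "\<And>v. v \<in> set ys \<Longrightarrow> E (xs ! i) v \<longleftrightarrow> v = last ys"
  proof (rule shortest_path_between[OF link_conn W(3) br W(1,2)])
  qed (use that in blast)
  have ne: "ys \<noteq> []" using ys(1) ipath_not_Nil by blast
  have yk: "y \<noteq> xs ! k" "E y (xs ! k) \<longleftrightarrow> k = i \<and> y = last ys" "E (xs ! k) y \<longleftrightarrow> k = i \<and> y = last ys"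
    if y: "y \<in> set ys" and k: "i \<le> k" "k \<le> n" for y k
  proof -
    have "E y (xs ! k) \<longleftrightarrow> k = i \<and> y = last ys" if "y \<noteq> xs ! k"
    proof (cases "k = i")
      case True
      then show ?thesis using yi[OF y] sym_iff by blast
    next
      case False
      have "\<not> E y (xs ! k)"
      proof (cases "y \<in> set rs")
        case True
        then show ?thesis using none rs_right(2)[OF True, of k] k False by (cases "y = hd rs") auto
      next
        case F: False
        then obtain l where "l < i" "y = xs ! l" using ys(2) y by blast
        then show ?thesis using adj[of l k] k False by auto
      qed
      then show ?thesis using False by simp
    qed
    moreover show "y \<noteq> xs ! k"
    proof
      assume yk: "y = xs ! k"
      then have "y \<notin> set rs" using nin(4) k by simp
      then obtain l where "l < i" "y = xs ! l" using ys(2) y by blast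
      then show False using eq[of l k] yk k by auto
    qed
    ultimately show "E y (xs ! k) \<longleftrightarrow> k = i \<and> y = last ys" by blast
    then show "E (xs ! k) y \<longleftrightarrow> k = i \<and> y = last ys" using sym_iff by blast
  qed
  have yn: "y \<noteq> b1 \<and> y \<noteq> b2 \<and> \<not> E b2 y" if y: "y \<in> set ys" for y
  proof (cases "y \<in> set rs")
    case True
    then show ?thesis using rs_new by blast
  next
    case False
    then obtain l where "l < i" "y = xs ! l" using ys(2) y by blast
    then show ?thesis using nin[of l] first[of l] i by auto
  qed
  have p1: "ipath (ys @ [xs ! i])"
    using ys(1) yk[of _ i] i by (intro ipath_append) auto
  have "hole b1 b2 (ys @ [xs ! i])"
    unfolding hole_def
    using p1 ne tri i yb yn nin[of i] right[of i] yk(1)[of "hd ys" i] yk(1)[of _ i]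
    by (cases ys) auto
  from even_hole[OF this] have e1: "even (Suc (length ys))" by simp
  have s: "i \<le> n - 1" "n - 1 \<le> n" using i by auto
  have p2: "ipath (ys @ seg xs i (n - 1))"
  proof (rule ipath_append[OF ys(1) sg(1)[OF s]])
    have "xs ! k \<notin> set ys" if "i \<le> k" "k \<le> n - 1" for k
      using yk(1)[of "xs ! k" k] that s(2) by auto
    then show "set ys \<inter> set (seg xs i (n - 1)) = {}" using sg(6)[OF s] by auto
    fix x y assume x: "x \<in> set ys" and y: "y \<in> set (seg xs i (n - 1))"
    then obtain k where k: "i \<le> k" "k \<le> n - 1" "y = xs ! k" using sg(6)[OF s] by blast
    then show "E x y \<longleftrightarrow> x = last ys \<and> y = hd (seg xs i (n - 1))"
      using yk(2)[OF x, of k] sg(2)[OF s] eq[of k i] i by auto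
  qed
  have "hole b1 (xs ! n) (ys @ seg xs i (n - 1))"
    unfolding hole_def
  proof (intro conjI ballI)
    show "2 \<le> length (ys @ seg xs i (n - 1))"
      using ne sg(4)[OF s] s i by (cases ys) auto
    show "E b1 (xs ! n)" using right[of n] by simp
    have "b1 \<notin> set ys" using yn by blast
    moreover have "b1 \<noteq> xs ! k" if "k \<le> n - 1" for k using nin(2)[of k] that s(2) by auto
    ultimately show "b1 \<notin> set (ys @ seg xs i (n - 1))" using sg(6)[OF s] by auto
    have "xs ! n \<notin> set ys" using yk(1)[of "xs ! n" n] i by auto
    moreover have "xs ! n \<noteq> xs ! k" if "k \<le> n - 1" for k using eq[of n k] that i by auto
    ultimately show "xs ! n \<notin> set (ys @ seg xs i (n - 1))" using sg(6)[OF s] by auto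
    fix x assume "x \<in> set (ys @ seg xs i (n - 1))"
    then consider "x \<in> set ys" | k where "i \<le> k" "k \<le> n - 1" "x = xs ! k" using sg(6)[OF s] by auto
    then have "(E b1 x \<longleftrightarrow> x = hd ys) \<and> (E (xs ! n) x \<longleftrightarrow> x = xs ! (n - 1))"
    proof cases
      case 1
      then show ?thesis using yb[OF 1] yk(3)[OF 1, of n] yk(1)[OF 1, of "n - 1"] i by auto
    next
      case 2
      have "hd ys \<noteq> x" using yk(1)[of "hd ys" k] ne 2 by auto
      then show ?thesis using 2 right[of k] adj[of n k] eq[of k "n - 1"] i by auto
    qed
    then show "E b1 x \<longleftrightarrow> x = hd (ys @ seg xs i (n - 1))"
      "E (xs ! n) x \<longleftrightarrow> x = last (ys @ seg xs i (n - 1))"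
      using ne sg(3,5)[OF s] by auto
  qed (use p2 in simp)
  moreover have "length (ys @ seg xs i (n - 1)) = length ys + (n - i)" using sg(4)[OF s] i by simp
  ultimately have "even (length ys + (n - i))" using even_hole by metis
  \<comment> \<open>\<open>n - i\<close> is even because both are odd, so the two cycles demand
    opposite parities of \<open>length ys\<close>.\<close>
  then show False using e1 odd_i odd_n i by simp
qed

private definition "z = Max {k. i < k \<and> k \<le> n \<and> E (hd rs) (xs ! k)}"

private lemma z: "i < z" "z \<le> n" "E (hd rs) (xs ! z)"
proof -
  have "finite {k. i < k \<and> k \<le> n \<and> E (hd rs) (xs ! k)}"
    "{k. i < k \<and> k \<le> n \<and> E (hd rs) (xs ! k)} \<noteq> {}" using far_neighbour by auto
  from Max_in[OF this, folded z_def] show "i < z" "z \<le> n" "E (hd rs) (xs ! z)" by auto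
qed

private lemma z_max:
  assumes "z < k" "k \<le> n"
  shows "\<not> E (hd rs) (xs ! k)"
proof
  assume "E (hd rs) (xs ! k)"
  then have "k \<le> z" unfolding z_def using assms z(1) by (intro Max_ge) auto
  then show False using assms by simp
qed

text \<open>The way from \<open>hd rs\<close> on to \<open>b1\<close>: nothing if they are adjacent,
  otherwise the end of the hole, entered at the last neighbour of \<open>hd rs\<close> so that the
  path stays induced.\<close>

private definition "zs = (if E (hd rs) b1 then [] else seg xs z n)"

private lemma zs_in: "x \<in> set zs \<Longrightarrow> \<exists>k. i < k \<and> k \<le> n \<and> x = xs ! k"
  using sg(6)[of z n x] z(1,2) order_less_le_trans[OF z(1)]
  by (cases "E (hd rs) b1") (simp_all add: zs_def, blast)

text \<open>\<open>us\<close> ends in \<open>hd rs\<close> because \<open>rs\<close> is run through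
  backwards, from the near side towards \<open>b1\<close>. It will be all of \<open>rs\<close>
  reversed, or an initial segment of \<open>rs\<close> reversed.\<close>

private lemma extend:
  assumes us: "ipath us" "set us \<subseteq> set rs" "last us = hd rs"
  shows "ipath (us @ zs)" "b1 \<notin> set (us @ zs)" "x \<in> set (us @ zs) \<Longrightarrow> E b1 x \<longleftrightarrow> x = last (us @ zs)"
proof -
  have une: "us \<noteq> []" using us(1) ipath_not_Nil by blast
  have "xs ! k \<noteq> b1" if "k \<le> n" for k using nin that by blast
  then show "b1 \<notin> set (us @ zs)" using us(2) rs_new zs_in by force
  have ub: "E b1 u \<Longrightarrow> u = hd rs" if "u \<in> set us" for u
    using rs_right(1)[of u] us(2) that sym by blast
  show "ipath (us @ zs)"
  proof (cases "E (hd rs) b1")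
    case True
    then show ?thesis using us by (simp add: zs_def)
  next
    case False
    note s = z(2) order_refl[of n]
    have d: "xs ! k \<notin> set us" if "z \<le> k" "k \<le> n" for k using nin(4) us(2) that by blast
    have "ipath (us @ seg xs z n)"
    proof (rule ipath_append[OF us(1) sg(1)[OF s]])
      show "set us \<inter> set (seg xs z n) = {}" using d sg(6)[OF s] by auto
      fix x y assume x: "x \<in> set us" and "y \<in> set (seg xs z n)"
      then obtain k where k: "z \<le> k" "k \<le> n" "y = xs ! k" using sg(6)[OF s] by blast
      have "E x y \<longleftrightarrow> x = hd rs \<and> k = z"
        using rs_right(2)[of x k] x us(2) z(1,3) z_max[of k] k
        by (cases "x = hd rs"; cases "k = z") auto
      then show "E x y \<longleftrightarrow> x = last us \<and> y = hd (seg xs z n)"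
        using us(3) sg(2)[OF s] k eq[of k z] z(2) by simp
    qed
    then show ?thesis using False by (simp add: zs_def)
  qed
  assume x: "x \<in> set (us @ zs)"
  show "E b1 x \<longleftrightarrow> x = last (us @ zs)"
  proof (cases "E (hd rs) b1")
    case True
    then have "E b1 (hd rs)" by (rule sym)
    then show ?thesis using True x us(3) ub by (auto simp: zs_def)
  next
    case False
    note s = z(2) order_refl[of n]
    have l: "last (us @ zs) = xs ! n" using False sg(3,5)[OF s] by (simp add: zs_def)
    show ?thesis
    proof (cases "x \<in> set us")
      case True
      then have "x \<noteq> xs ! n" using us(2) nin(4) by blast
      moreover have "\<not> E b1 x" using ub[OF True] False sym by blast
      ultimately show ?thesis using l by simp
    next
      case F: False
      then obtain k where "k \<le> n" "x = xs ! k" using x zs_in by auto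
      then show ?thesis using l right[of k] eq[of k n] by simp
    qed
  qed
qed

private lemma rs_avoid: "a \<notin> set rs"
  using rs_new tri(2) sym by blast

text \<open>The new hole follows the old one up to the first neighbour of \<open>last rs\<close>,
  then \<open>rs\<close> backwards, then \<open>zs\<close>. If \<open>b2\<close> did not see it, the
  stretch of the old hole from \<open>Suc x\<close> to \<open>i\<close> would link \<open>b2\<close>
  to it, contrary to \<open>no_link\<close>.\<close>

private lemma detour_avoiding:
  assumes none: "\<And>y. y \<in> set rs \<Longrightarrow> \<not> E a y"
  shows "\<exists>ys. hole a b1 ys \<and> hd ys = hd xs \<and> b2 \<notin> set ys \<and> (\<exists>y\<in>set ys. E b2 y)
    \<and> {y \<in> set ys. E b2 y} \<subseteq> {xs ! k | k. i < k \<and> k \<le> n}"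
proof -
  define x where "x = (LEAST k. E (last rs) (xs ! k))"
  obtain k0 where k0: "k0 < i" "E (last rs) (xs ! k0)" using rs_last r_in by blast
  have "x \<le> k0" unfolding x_def by (rule Least_le) (rule k0)
  then have x: "E (last rs) (xs ! x)" "x < i"
    using LeastI[of "\<lambda>k. E (last rs) (xs ! k)", OF k0(2)] k0(1) by (auto simp: x_def)
  have xmin: "\<not> E (last rs) (xs ! k)" if "k < x" for k
    using that not_less_Least unfolding x_def by blast
  have s: "0 \<le> x" "x \<le> n" using x i by auto
  have zi: "y \<in> set zs \<Longrightarrow> \<exists>k. i < k \<and> k \<le> n \<and> y = xs ! k" for y by (rule zs_in)
  have rv: "ipath (rev rs)" "set (rev rs) \<subseteq> set rs" "last (rev rs) = hd rs"
    using rs rs_ne by (auto simp: last_rev)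
  note ex = extend[OF rv]
  let ?ys = "seg xs 0 x @ rev rs @ zs"
  have p: "ipath ?ys"
  proof (rule ipath_append[OF sg(1)[OF s] ex(1)])
    have "xs ! k \<notin> set rs \<union> set zs" if "k \<le> x" for k
      using that x(2) i nin(4)[of k] zi[of "xs ! k"] eq[of k] by fastforce
    then show "set (seg xs 0 x) \<inter> set (rev rs @ zs) = {}" using sg(6)[OF s] by auto
    fix u y assume "u \<in> set (seg xs 0 x)" and y: "y \<in> set (rev rs @ zs)"
    then obtain k where k: "k \<le> x" "u = xs ! k" using sg(6)[OF s] by blast
    have hl: "hd (rev rs @ zs) = last rs" using rs_ne by (simp add: hd_rev)
    have "E y u \<longleftrightarrow> u = xs ! x \<and> y = last rs"
    proof (cases "y \<in> set rs")
      case True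
      then show ?thesis
        using rs_left[OF True, of k] x xmin[of k] k eq[of k x] s by (cases "k = x"; cases "y = last rs") auto
    next
      case False
      then obtain l where l: "i < l" "l \<le> n" "y = xs ! l" using y zi by auto
      then have "\<not> E y u" using adj[of l k] k x by auto
      moreover have "y \<noteq> last rs" using False r_in by auto
      ultimately show ?thesis by simp
    qed
    then show "E u y \<longleftrightarrow> u = last (seg xs 0 x) \<and> y = hd (rev rs @ zs)"
      using sg(3)[OF s] hl sym_iff[of u y] by simp
  qed
  have mem: "(\<exists>k\<le>x. y = xs ! k) \<or> y \<in> set (rev rs @ zs)" if "y \<in> set ?ys" for y
    using that sg(6)[OF s] by auto
  have hy: "hd ?ys = xs ! 0" "last ?ys = last (rev rs @ zs)"
    using sg(2,5)[OF s] rs_ne by auto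
  have hx: "hd xs = xs ! 0" using n by (cases xs) auto
  have tail_a: "\<not> E a y" "y \<noteq> a" "y \<noteq> xs ! 0" "y \<noteq> b2" if y: "y \<in> set (rev rs @ zs)" for y
  proof -
    have "\<not> E a y \<and> y \<noteq> a \<and> y \<noteq> xs ! 0 \<and> y \<noteq> b2"
    proof (cases "y \<in> set rs")
      case True
      then show ?thesis using none rs_avoid rs_new[OF True] nin(4)[of 0] by auto
    next
      case False
      then obtain l where "i < l" "l \<le> n" "y = xs ! l" using y zi by auto
      then show ?thesis using left[of l] nin[of l] eq[of l 0] by auto
    qed
    then show "\<not> E a y" "y \<noteq> a" "y \<noteq> xs ! 0" "y \<noteq> b2" by auto
  qed
  have h': "hole a b1 ?ys"
    unfolding hole_def
  proof (intro conjI ballI)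
    show "2 \<le> length ?ys" using sg(4)[OF s] rs_ne by (cases rs) auto
    show "E a b1" by (rule tri)
    show "a \<notin> set ?ys" using mem tail_a nin(1) s by (metis order_trans)
    show "b1 \<notin> set ?ys" using mem ex(2) nin(2) s by (metis order_trans)
    fix y assume "y \<in> set ?ys"
    from mem[OF this] have "(E a y \<longleftrightarrow> y = xs ! 0) \<and> (E b1 y \<longleftrightarrow> y = last (rev rs @ zs))"
    proof
      assume "\<exists>k\<le>x. y = xs ! k"
      then obtain k where k: "k \<le> x" "y = xs ! k" by blast
      have "last (rev rs @ zs) \<in> set (rev rs @ zs)" using rs_ne by (intro last_in_set) simp
      then have "last (rev rs @ zs) \<noteq> y"
        using zi[of y] eq[of k] nin(4)[of k] k x i by fastforce
      then show ?thesis using k left[of k] right[of k] eq[of k 0] x i by auto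
    next
      assume "y \<in> set (rev rs @ zs)"
      then show ?thesis using tail_a ex(3) by blast
    qed
    then show "E a y \<longleftrightarrow> y = hd ?ys" "E b1 y \<longleftrightarrow> y = last ?ys" using hy by auto
  qed (use p in simp)
  have nb2: "b2 \<notin> set ?ys" using mem tail_a nin(3) s by (metis order_trans)
  have marks: "\<exists>k. i < k \<and> k \<le> n \<and> y = xs ! k" if y: "y \<in> set ?ys" "E b2 y" for y
    using mem[OF y(1)] y(2) first x(2) rs_new zi by (metis Un_iff order_le_less_trans set_append set_rev)
  have "\<exists>y\<in>set ?ys. E b2 y"
  proof (rule ccontr)
    assume no: "\<not> ?thesis"
    have t: "Suc x \<le> i" "i \<le> n" using x i by auto
    show False
    proof (rule no_link[OF h' nb2 _ _ _ conn_ipath[OF sg(1)[OF t]], of "xs ! i" "xs ! Suc x" "xs ! x"])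
      have "xs ! x \<in> set (seg xs 0 x)" using sg(6)[OF s] by blast
      then show "xs ! x \<in> set ?ys" by simp
      show "E (xs ! Suc x) (xs ! x)" using adj[of "Suc x" x] x i by auto
      show "w \<noteq> a \<and> \<not> E a w" "w \<noteq> b1 \<and> \<not> E b1 w" if w: "w \<in> set (seg xs (Suc x) i)" for w
      proof -
        obtain m where m: "Suc x \<le> m" "m \<le> i" "w = xs ! m" using w sg(6)[OF t] by blast
        show "w \<noteq> a \<and> \<not> E a w" "w \<noteq> b1 \<and> \<not> E b1 w"
          using m left[of m] right[of m] nin[of m] i by auto
      qed
      have "b2 \<noteq> xs ! m" if "m \<le> i" for m using nin(3)[of m] that i by auto
      then show "b2 \<notin> set (seg xs (Suc x) i)" using sg(6)[OF t] by blast
    qed (use no sg(6)[OF t] t i(1) sym[OF tri(2)] sym[OF tri(3)] in auto)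
  qed
  then show ?thesis using h' hy(1) hx nb2 marks by (intro exI[of _ ?ys]) auto
qed

text \<open>Otherwise \<open>b2\<close> and \<open>hd rs\<close> are nonadjacent and both complete
  to the edge \<open>a b1\<close>, and \<open>two_centres\<close> leaves \<open>last xs\<close> as
  the only neighbour of \<open>b2\<close>, which however sees \<open>xs ! i\<close> with
  \<open>i < n\<close>.\<close>

private lemma not_complete: "\<not> (E a (hd rs) \<and> E b1 (hd rs))"
proof
  assume r: "E a (hd rs) \<and> E b1 (hd rs)"
  have "\<not> E b2 (hd xs)" using first[of 0] i n by (cases xs) auto
  moreover have "hd rs \<notin> set xs" "b2 \<noteq> hd rs" "\<not> E b2 (hd rs)" using rs_new r_in(1) by blast+
  moreover have "E b2 a" "E b2 b1" "E (hd rs) a" "E (hd rs) b1" using tri r sym by blast+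
  ultimately have "\<forall>x\<in>set xs. E b2 x \<longleftrightarrow> x = last xs"
    using two_centres(1)[OF h b2, of "hd rs" "xs ! i" "xs ! z"] nth_in[of i] nth_in[of z] z i by simp
  moreover have "last xs = xs ! n" using n last_conv_nth[of xs] by force
  ultimately have "xs ! i = xs ! n" using i(1,3) nth_in[of i] by simp
  then show False using eq[of i n] i by simp
qed

text \<open>In this configuration \<open>b1\<close>, \<open>hd rs\<close> and \<open>xs ! n\<close>
  form a triangle. Its edge from \<open>hd rs\<close> to \<open>xs ! n\<close> lies on a hole that
  passes through \<open>xs ! i\<close> and the far side, and \<open>b1\<close> is linked to
  \<open>xs ! i\<close> through \<open>a\<close> and the start of the old hole.\<close>

private lemma corner:
  assumes r: "E (hd rs) b1" "\<not> E a (hd rs)" "hd rs \<noteq> last rs" "E (hd rs) (xs ! n)"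
    and gap: "\<And>k. i < k \<Longrightarrow> k < n \<Longrightarrow> \<not> E (hd rs) (xs ! k)"
  shows False
proof -
  have tl: "rs = hd rs # tl rs" "tl rs \<noteq> []" using rs_ne r(3) by (cases rs; cases "tl rs"; auto)+
  then have t: "ipath (tl rs)" "E (hd rs) (hd (tl rs))" "hd rs \<notin> set (tl rs)"
    using rs ipath_Cons[OF tl(2), of "hd rs"] by auto
  have tin: "y \<in> set rs \<and> y \<noteq> hd rs" if "y \<in> set (tl rs)" for y
    using that t(3) by (metis list.set_sel(2) rs_ne)
  have lt: "last rs = last (tl rs)" using tl by (metis last_ConsR)
  obtain k0 where k0: "k0 < i" "E (last rs) (xs ! k0)" using rs_last r_in by blast
  \<comment> \<open>Both numbers are odd, so at least one vertex lies strictly between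
    \<open>xs ! i\<close> and \<open>xs ! n\<close>.\<close>
  have i2: "Suc (Suc i) \<le> n" using i odd_i odd_n by (cases "n = Suc i") auto
  let ?W = "(set (tl rs) \<union> {xs ! k | k. k < i}) \<union> {xs ! i}"
  have "conn (set (tl rs) \<union> {xs ! k | k. k < i})"
    using conn_Un[OF conn_ipath[OF t(1)] start_conn, of "last rs" "xs ! k0"] k0 lt tl(2) by auto
  moreover have "xs ! (i - 1) \<in> set (tl rs) \<union> {xs ! k | k. k < i}" "E (xs ! (i - 1)) (xs ! i)"
    using i adj[of "i - 1" i] by auto
  ultimately have W: "conn ?W"
    using conn_Un[of "set (tl rs) \<union> {xs ! k | k. k < i}" "{xs ! i}" "xs ! (i - 1)" "xs ! i"] by simp
  have ends: "hd (tl rs) \<in> ?W" "xs ! i \<in> ?W" "E (xs ! Suc i) (xs ! i)"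
    using tl(2) adj[of "Suc i" i] i by auto
  obtain ys where ys: "ipath ys" "set ys \<subseteq> ?W"
    and yr: "\<And>v. v \<in> set ys \<Longrightarrow> E (hd rs) v \<longleftrightarrow> v = hd ys"
    and yi: "\<And>v. v \<in> set ys \<Longrightarrow> E (xs ! Suc i) v \<longleftrightarrow> v = last ys"
  proof (rule shortest_path_between[OF W ends(1) t(2) ends(2,3)])
  qed (use that in blast)
  have ne: "ys \<noteq> []" using ys(1) ipath_not_Nil by blast
  have yW: "y \<in> set rs \<and> y \<noteq> hd rs \<or> (\<exists>k\<le>i. y = xs ! k)" if y: "y \<in> set ys" for y
  proof -
    have "y \<in> set (tl rs) \<or> (\<exists>k<i. y = xs ! k) \<or> y = xs ! i" using ys(2) y by blast
    then show ?thesis using tin less_imp_le by blast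
  qed
  have far: "y \<noteq> xs ! k" "E (xs ! k) y \<longleftrightarrow> k = Suc i \<and> y = xs ! i"
    if y: "y \<in> set ys" and k: "i < k" "k \<le> n" for y k
  proof -
    have "y \<noteq> xs ! k \<and> (E y (xs ! k) \<longleftrightarrow> k = Suc i \<and> y = xs ! i)"
      using yW[OF y]
    proof
      assume yrs: "y \<in> set rs \<and> y \<noteq> hd rs"
      then have "y \<noteq> xs ! k" "y \<noteq> xs ! i" using nin(4)[of k] nin(4)[of i] k i by auto
      then show ?thesis using yrs rs_right(2)[of y k] k by blast
    next
      assume "\<exists>k\<le>i. y = xs ! k"
      then obtain l where "l \<le> i" "y = xs ! l" by blast
      then show ?thesis using adj[of l k] eq[of l k] eq[of l i] k i by auto
    qed
    then show "y \<noteq> xs ! k" "E (xs ! k) y \<longleftrightarrow> k = Suc i \<and> y = xs ! i" using sym_iff by blast+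
  qed
  have ly: "last ys = xs ! i" using yi[of "last ys"] far(2)[of "last ys" "Suc i"] ne i by auto
  have s: "Suc i \<le> n - 1" "n - 1 \<le> n" using i2 by auto
  have p: "ipath (ys @ seg xs (Suc i) (n - 1))"
  proof (rule ipath_append[OF ys(1) sg(1)[OF s]])
    have "xs ! k \<notin> set ys" if "Suc i \<le> k" "k \<le> n - 1" for k
      using far(1)[of "xs ! k" k] that s(2) by auto
    then show "set ys \<inter> set (seg xs (Suc i) (n - 1)) = {}" using sg(6)[OF s] by auto
    fix x y assume x: "x \<in> set ys" and y: "y \<in> set (seg xs (Suc i) (n - 1))"
    then obtain k where k: "Suc i \<le> k" "k \<le> n - 1" "y = xs ! k" using sg(6)[OF s] by blast
    have "E y x \<longleftrightarrow> x = last ys \<and> y = hd (seg xs (Suc i) (n - 1))"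
      using far(2)[OF x, of k] sg(2)[OF s] eq[of k "Suc i"] i2 k ly by auto
    then show "E x y \<longleftrightarrow> x = last ys \<and> y = hd (seg xs (Suc i) (n - 1))" using sym_iff by blast
  qed
  have mem: "y \<in> set ys \<or> (\<exists>k. i < k \<and> k < n \<and> y = xs ! k)"
    if "y \<in> set (ys @ seg xs (Suc i) (n - 1))" for y
  proof -
    have "m \<le> n - 1 \<longleftrightarrow> m < n" for m using i2 by auto
    then show ?thesis using that sg(6)[OF s, of y] by (auto simp: Suc_le_eq)
  qed
  have hl: "hd (ys @ seg xs (Suc i) (n - 1)) = hd ys" "last (ys @ seg xs (Suc i) (n - 1)) = xs ! (n - 1)"
    using ne sg(3,5)[OF s] by auto
  have h': "hole (hd rs) (xs ! n) (ys @ seg xs (Suc i) (n - 1))"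
    unfolding hole_def hl
  proof (intro conjI ballI)
    show "2 \<le> length (ys @ seg xs (Suc i) (n - 1))" using ne sg(5)[OF s] by (cases ys; cases "seg xs (Suc i) (n - 1)") auto
    have "hd rs \<notin> set ys" using yW[of "hd rs"] nin(4) r_in(1) i by fastforce
    moreover have "hd rs \<noteq> xs ! k" if "k < n" for k using nin(4)[of k] r_in(1) that by auto
    ultimately show "hd rs \<notin> set (ys @ seg xs (Suc i) (n - 1))" using mem by blast
    have "xs ! n \<notin> set ys" using far(1)[of "xs ! n" n] i by auto
    moreover have "xs ! n \<noteq> xs ! k" if "k < n" for k using eq[of n k] that by auto
    ultimately show "xs ! n \<notin> set (ys @ seg xs (Suc i) (n - 1))" using mem by blast
    fix x assume "x \<in> set (ys @ seg xs (Suc i) (n - 1))"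
    from mem[OF this]
    have "(E (hd rs) x \<longleftrightarrow> x = hd ys) \<and> (E (xs ! n) x \<longleftrightarrow> x = xs ! (n - 1))"
    proof
      assume x: "x \<in> set ys"
      have "n - 1 \<noteq> i" using i2 by auto
      then show ?thesis
        using yr[OF x] far(2)[OF x, of n] far(1)[OF x, of "n - 1"] i2 by auto
    next
      assume "\<exists>k. i < k \<and> k < n \<and> x = xs ! k"
      then obtain k where k: "i < k" "k < n" "x = xs ! k" by blast
      have "hd ys \<noteq> x" using far(1)[of "hd ys" k] ne k by auto
      then show ?thesis using k gap[of k] adj[of n k] eq[of k "n - 1"] by auto
    qed
    then show "E (hd rs) x \<longleftrightarrow> x = hd ys" "E (xs ! n) x \<longleftrightarrow> x = xs ! (n - 1)" by auto
  qed (use p r in auto)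
  have b1y: "\<not> E b1 y \<and> y \<noteq> b1" if y: "y \<in> set (ys @ seg xs (Suc i) (n - 1))" for y
  proof -
    have "y \<in> set rs \<and> y \<noteq> hd rs \<or> (\<exists>k<n. y = xs ! k)"
      using mem[OF y]
    proof
      assume "y \<in> set ys"
      then show ?thesis using yW[of y] i(3) order_le_less_trans by blast
    qed blast
    then show ?thesis
    proof
      assume "y \<in> set rs \<and> y \<noteq> hd rs"
      then show ?thesis using rs_right(1)[of y] rs_new[of y] sym by blast
    next
      assume "\<exists>k<n. y = xs ! k"
      then obtain k where "k < n" "y = xs ! k" by blast
      then show ?thesis using right[of k] nin(2)[of k] by auto
    qed
  qed
  let ?T = "{a} \<union> {xs ! k | k. k < i}"
  have T: "conn ?T"
  proof (rule conn_Un[OF conn_single start_conn])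
    show "xs ! 0 \<in> {xs ! k | k. k < i}" using i by auto
    show "a = xs ! 0 \<or> E a (xs ! 0)" using left[of 0] by simp
  qed simp
  have Tx: "w \<noteq> hd rs \<and> \<not> E (hd rs) w" "w \<noteq> xs ! n \<and> \<not> E (xs ! n) w" "w \<noteq> b1" if w: "w \<in> ?T" for w
  proof -
    have "w \<noteq> hd rs \<and> \<not> E (hd rs) w \<and> w \<noteq> xs ! n \<and> \<not> E (xs ! n) w \<and> w \<noteq> b1"
    proof (cases "w = a")
      case True
      have "\<not> E (hd rs) a" "\<not> E (xs ! n) a" using r(2) left[of n] sym i by auto
      then show ?thesis using True rs_avoid r_in nin(1)[of n] tri(1) irrefl by auto
    next
      case False
      then obtain k where k: "k < i" "w = xs ! k" using w by blast
      then show ?thesis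
        using rs_left[OF r_in(1) r(3) k(1)] nin(2,4)[of k] r_in(1) adj[of n k] eq[of k n] i by auto
    qed
    then show "w \<noteq> hd rs \<and> \<not> E (hd rs) w" "w \<noteq> xs ! n \<and> \<not> E (xs ! n) w" "w \<noteq> b1" by auto
  qed
  show False
  proof (rule no_link[OF h' _ _ _ _ T _ _ _ _ _ _ Tx(1) Tx(2)])
    show "b1 \<notin> set (ys @ seg xs (Suc i) (n - 1))" using b1y by blast
    show "E b1 (hd rs)" using r(1) by (rule sym)
    show "E b1 (xs ! n)" using right[of n] by simp
    show "\<not> E b1 x" if "x \<in> set (ys @ seg xs (Suc i) (n - 1))" for x using b1y[OF that] by simp
    show "b1 \<notin> ?T" using Tx(3) by blast
    show "a \<in> ?T" by simp
    show "E b1 a" using tri(1) by (rule sym)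
    show "xs ! (i - 1) \<in> ?T" using i by auto
    show "xs ! i \<in> set (ys @ seg xs (Suc i) (n - 1))" using ly last_in_set[OF ne] by simp
    show "E (xs ! (i - 1)) (xs ! i)" using adj[of "i - 1" i] i by simp
  qed
qed

text \<open>The vertex \<open>rs ! j\<close> takes over the part of \<open>c\<close>: the new hole
  runs from it back to \<open>hd rs\<close> and on to \<open>b1\<close>. If \<open>b2\<close> did
  not see it, the old hole from \<open>xs ! i\<close> on would be a link, provided that it arrives
  before \<open>xs ! n\<close>, which \<open>b1\<close> sees; \<open>corner\<close> covers the one
  case where it does not.\<close>

private lemma detour_through:
  assumes j: "j < length rs" "E a (rs ! j)" and jmin: "\<And>k. k < j \<Longrightarrow> \<not> E a (rs ! k)"
  shows "\<exists>ys. hole a b1 ys \<and> hd ys = rs ! j \<and> b2 \<notin> set ys \<and> (\<exists>y\<in>set ys. E b2 y)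
    \<and> {y \<in> set ys. E b2 y} \<subseteq> {xs ! k | k. i < k \<and> k \<le> n}"
proof -
  note s = le0[of j] j(1)
  have hd0: "hd rs = rs ! 0" using rs_ne by (rule hd_conv_nth)
  have req: "rs ! k = rs ! l \<longleftrightarrow> k = l" if "k \<le> j" "l \<le> j" for k l
    using that j(1) ipath_distinct[OF rs] by (simp add: nth_eq_iff_index_eq)
  define us where "us = rev (seg rs 0 j)"
  have us: "ipath us" "set us \<subseteq> set rs" "last us = hd rs" "us \<noteq> []" "hd us = rs ! j" "length us = Suc j"
    using ipath_seg[OF rs s] in_seg[OF s] j(1) seg_not_Nil[OF s] hd_seg[OF s] last_seg[OF s] length_seg[OF s]
    by (auto simp: us_def last_rev hd_rev hd0)
  have usk: "\<exists>k\<le>j. u = rs ! k" if "u \<in> set us" for u using that in_seg[OF s] by (simp add: us_def)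
  note ex = extend[OF us(1-3)]
  let ?ys = "us @ zs"
  have mem: "(\<exists>k\<le>j. y = rs ! k) \<or> (\<exists>k. i < k \<and> k \<le> n \<and> y = xs ! k)" if "y \<in> set ?ys" for y
    using that usk zs_in by (metis UnE set_append)
  have rin: "rs ! k \<in> set rs" if "k \<le> j" for k using that j(1) by simp
  have ya: "y \<noteq> a \<and> y \<noteq> b2 \<and> (E a y \<longleftrightarrow> y = rs ! j)" if "y \<in> set ?ys" for y
    using mem[OF that]
  proof
    assume "\<exists>k\<le>j. y = rs ! k"
    then obtain k where k: "k \<le> j" "y = rs ! k" by blast
    have "E a y \<longleftrightarrow> k = j" using jmin[of k] j(2) k by (cases "k = j") auto
    then show ?thesis using k req[of k j] rs_avoid rs_new[OF rin[OF k(1)]] rin[OF k(1)] by auto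
  next
    assume "\<exists>k. i < k \<and> k \<le> n \<and> y = xs ! k"
    then obtain k where "i < k" "k \<le> n" "y = xs ! k" by blast
    then show ?thesis using left[of k] nin[of k] rin[of j] by auto
  qed
  have h': "hole a b1 ?ys"
    unfolding hole_def
  proof (intro conjI ballI)
    \<comment> \<open>A hole needs two vertices besides its named edge. For \<open>j = 0\<close> the
      vertex \<open>hd rs\<close> sees \<open>a\<close>, hence not \<open>b1\<close>, and
      \<open>zs\<close> supplies the second one.\<close>
    have "zs \<noteq> []" if "j = 0"
    proof -
      have "\<not> E b1 (hd rs)" using not_complete j(2) that hd0 by simp
      then have "\<not> E (hd rs) b1" using sym by blast
      then show ?thesis using sg(5)[of z n] z(2) by (simp add: zs_def)
    qed
    then show "2 \<le> length ?ys" using us(6) by (cases j; cases zs) auto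
    show "E a b1" by (rule tri)
    show "a \<notin> set ?ys" using ya by blast
    fix x assume "x \<in> set ?ys"
    then show "E a x \<longleftrightarrow> x = hd ?ys" "E b1 x \<longleftrightarrow> x = last ?ys" using ya ex(3) us(4,5) by auto
  qed (use ex in auto)
  have nb2: "b2 \<notin> set ?ys" using ya by blast
  have marks: "\<exists>k. i < k \<and> k \<le> n \<and> y = xs ! k" if "y \<in> set ?ys" "E b2 y" for y
    using mem[OF that(1)] that(2) rs_new rin by blast
  have "\<exists>y\<in>set ?ys. E b2 y"
  proof (rule ccontr)
    assume no: "\<not> ?thesis"
    have link: False if k: "i \<le> k" "k < n" and x: "x \<in> set ?ys" "E (xs ! k) x" for k x
    proof -
      have t: "i \<le> k" "k \<le> n" using k by auto
      show False
      proof (rule no_link[OF h' nb2 _ _ _ conn_ipath[OF sg(1)[OF t]] _ _ i(1) _ x])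
        show "xs ! i \<in> set (seg xs i k)" "xs ! k \<in> set (seg xs i k)" using sg(6)[OF t] k by auto
        have "b2 \<noteq> xs ! m" if "m \<le> k" for m using nin(3)[of m] that k by auto
        then show "b2 \<notin> set (seg xs i k)" using sg(6)[OF t] by blast
        show "w \<noteq> a \<and> \<not> E a w" "w \<noteq> b1 \<and> \<not> E b1 w" if w: "w \<in> set (seg xs i k)" for w
        proof -
          obtain m where m: "i \<le> m" "m \<le> k" "w = xs ! m" using w sg(6)[OF t] by blast
          show "w \<noteq> a \<and> \<not> E a w" "w \<noteq> b1 \<and> \<not> E b1 w"
            using m left[of m] right[of m] nin[of m] i k by auto
        qed
      qed (use no sym[OF tri(2)] sym[OF tri(3)] in auto)
    qed
    show False
    proof (cases "E (hd rs) b1")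
      case False
      have "xs ! z \<in> set ?ys" using sg(6)[of z n "xs ! z"] z(2) False by (auto simp: zs_def)
      moreover have "E (xs ! (z - 1)) (xs ! z)" using adj[of "z - 1" z] z by auto
      moreover have "i \<le> z - 1" "z - 1 < n" using z by auto
      ultimately show False using link by blast
    next
      case True
      then have na: "\<not> E a (hd rs)" using not_complete sym by blast
      then have "j \<noteq> 0" using j(2) hd0 by metis
      define k where "k = (LEAST k. i < k \<and> E (hd rs) (xs ! k))"
      have k: "i < k" "E (hd rs) (xs ! k)" "k \<le> z"
        using LeastI[of "\<lambda>k. i < k \<and> E (hd rs) (xs ! k)" z] Least_le[of "\<lambda>k. i < k \<and> E (hd rs) (xs ! k)" z] z
        unfolding k_def by blast+
      have gap: "\<not> E (hd rs) (xs ! l)" if "i < l" "l < k" for l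
        using that not_less_Least[of l "\<lambda>k. i < k \<and> E (hd rs) (xs ! k)"] unfolding k_def by blast
      have hr: "hd rs \<in> set ?ys" using us(3,4) last_in_set[OF us(4)] by simp
      show False
      proof (cases "k = n")
        case True
        have "0 < length rs" "length rs - 1 < length rs" "0 \<noteq> length rs - 1" using \<open>j \<noteq> 0\<close> j(1) by auto
        then have "hd rs \<noteq> last rs"
          unfolding hd0 last_conv_nth[OF rs_ne] using ipath_distinct[OF rs] nth_eq_iff_index_eq by blast
        then show False using corner[OF \<open>E (hd rs) b1\<close> na _ _ gap] k(2) True by blast
      next
        case False
        then have "i \<le> k" "k < n" using k z(2) by auto
        then show False using link hr sym[OF k(2)] by blast
      qed
    qed
  qed
  then show ?thesis using h' us(4,5) nb2 marks by (intro exI[of _ ?ys]) auto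
qed

text \<open>The clause about \<open>rs\<close> from position \<open>j\<close> on is what later
  transfers \<open>linked b1 b2\<close> to the new first vertex: this part of \<open>rs\<close>
  leads back to the old hole without seeing \<open>b1\<close>.\<close>

lemma detour:
  "\<exists>ys. hole a b1 ys \<and> b2 \<notin> set ys \<and> (\<exists>y\<in>set ys. E b2 y)
    \<and> {y \<in> set ys. E b2 y} \<subseteq> {xs ! k | k. i < k \<and> k \<le> n}
    \<and> (hd ys = hd xs \<or> (\<exists>j<length rs. hd ys = rs ! j \<and> (\<forall>k<length rs. j \<le> k \<longrightarrow> \<not> E b1 (rs ! k))))"
proof (cases "\<exists>y\<in>set rs. E a y")
  case False
  then show ?thesis using detour_avoiding by blast
next
  case True
  then obtain j0 where j0: "j0 < length rs" "E a (rs ! j0)" by (metis in_set_conv_nth)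
  define j where "j = (LEAST k. E a (rs ! k))"
  have j: "E a (rs ! j)" unfolding j_def using j0(2) by (rule LeastI)
  have "j \<le> j0" unfolding j_def using j0(2) by (rule Least_le)
  then have jl: "j < length rs" using j0(1) by simp
  have jmin: "\<not> E a (rs ! k)" if "k < j" for k using that not_less_Least unfolding j_def by blast
  have hd0: "hd rs = rs ! 0" using rs_ne by (rule hd_conv_nth)
  have "\<not> E b1 (rs ! k)" if k: "k < length rs" "j \<le> k" for k
  proof (cases "k = 0")
    case True
    then show ?thesis using not_complete j k hd0 by auto
  next
    case False
    then have "rs ! k \<noteq> hd rs"
      using hd0 ipath_distinct[OF rs] k rs_ne by (simp add: nth_eq_iff_index_eq)
    then show ?thesis using rs_right(1)[of "rs ! k"] k(1) sym nth_mem by blast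
  qed
  then show ?thesis using detour_through[OF jl j jmin] jl by blast
qed

end

text \<open>For \<open>c\<close> outside \<open>N[b]\<close> and adjacent \<open>b\<close>,
  \<open>b'\<close>, this holds whenever \<open>b\<close> does not break \<open>{c, b'}\<close>.
  Asking for any connected set, not a component, allows links to be glued together.\<close>

definition linked :: "'a \<Rightarrow> 'a \<Rightarrow> 'a \<Rightarrow> bool" where
  "linked b b' c \<longleftrightarrow> (\<exists>A. conn A \<and> c \<in> A \<and> (\<forall>y\<in>A. y \<noteq> b \<and> \<not> E b y) \<and> (\<exists>y\<in>A. E b' y))"

lemma linked_arm:
  assumes "linked b2 b1 c" and S: "c \<in> set S" "\<And>x. x \<in> set S \<Longrightarrow> \<not> E b1 x"
  obtains rs where "arm b1 b2 S rs"
proof -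
  obtain A y where A: "conn A" "c \<in> A" "\<And>y. y \<in> A \<Longrightarrow> y \<noteq> b2 \<and> \<not> E b2 y" and y: "y \<in> A" "E b1 y"
    using assms(1) unfolding linked_def by blast
  \<comment> \<open>So \<open>A\<close> has a second vertex, and \<open>c\<close> has a neighbour in
    \<open>A\<close>, which can end a walk from \<open>b1\<close> towards \<open>S\<close>.\<close>
  have "y \<noteq> c" using y S by blast
  then obtain z where z: "z \<in> A" "E z c" using conn_neighbour[OF A(1,2) y(1)] by metis
  obtain rs where rs: "ipath rs" "set rs \<subseteq> A"
    and rb: "\<And>v. v \<in> set rs \<Longrightarrow> (\<exists>y\<in>{b1}. E y v) \<longleftrightarrow> v = hd rs"
    and rS: "\<And>v. v \<in> set rs \<Longrightarrow> (\<exists>x\<in>set S. E v x) \<longleftrightarrow> v = last rs"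
    and dis: "(\<And>y x. y \<in> {b1} \<Longrightarrow> x \<in> set S \<Longrightarrow> \<not> E y x) \<Longrightarrow> set rs \<inter> (set S \<union> {b1}) = {}"
  proof (rule shortest_path[OF A(1) y(1) singletonI y(2) z(1) S(1) z(2)])
  qed (use that in blast)
  have d: "set rs \<inter> (set S \<union> {b1}) = {}" by (rule dis) (use S(2) in auto)
  have "arm b1 b2 S rs" unfolding arm_def using rs(1) rb rS d A(3) rs(2) by auto
  then show thesis by (rule that)
qed

text \<open>The twin configuration consists of \<open>a\<close>, \<open>butlast xs\<close> and
  \<open>last xs\<close>, and the two links supply the arms. These miss \<open>a\<close> and
  \<open>last xs\<close>, which are adjacent to both \<open>b1\<close> and
  \<open>b2\<close>.\<close>

lemma attached_only_at_end:
  assumes tri: "E a b1" "E a b2" "E b1 b2" and h: "hole a b1 xs" and b2: "b2 \<notin> set xs"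
    and mark: "\<And>x. x \<in> set xs \<Longrightarrow> E b2 x \<longleftrightarrow> x = last xs"
    and linked: "linked b2 b1 (hd xs)" "linked b1 b2 (hd xs)"
  shows False
proof -
  define S p where "S = butlast xs" and "p = last xs"
  have xs: "xs = S @ [p]" using hole_not_Nil[OF h] by (simp add: S_def p_def)
  have Sne: "S \<noteq> []" using hole_length[OF h] xs by auto
  have rx: "ipath (p # rev S)" using hole_ipath[OF h] ipath_rev[of xs] by (simp add: xs)
  have S: "ipath S" "p \<notin> set S" "\<And>x. x \<in> set S \<Longrightarrow> E p x \<longleftrightarrow> x = last S"
    using rx Sne ipath_Cons[of "rev S" p] by (auto simp: hd_rev)
  have hdxs: "hd xs = hd S" using xs Sne by simp
  have ax: "E a x \<longleftrightarrow> x = hd S" "E b1 x \<longleftrightarrow> x = p" "x \<noteq> a" "x \<noteq> b1" if "x \<in> set xs" for x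
    using h that hdxs by (auto simp: hole_def p_def)
  have pin: "p \<in> set xs" and sub: "set S \<subseteq> set xs" using xs by auto
  have "p \<noteq> hd S" using S(2) Sne hd_in_set by blast
  then have ap: "\<not> E a p" using ax(1)[OF pin] by simp
  have pb: "E p b1" "E p b2" using ax(2)[OF pin] mark[OF pin] sym by (auto simp: p_def)
  have nb: "x \<noteq> b1 \<and> \<not> E b1 x \<and> x \<noteq> b2 \<and> \<not> E b2 x" if "x \<in> set S" for x
    using ax[of x] mark[of x] that sub S(2) b2 by (auto simp: p_def)
  have tw: "twin a p b1 b2 S"
    unfolding twin_def using S tri pb ap ax(1,3) pin sub nb by auto
  have "hd xs \<in> set S" using hdxs Sne by simp
  then obtain rs ss where arms: "arm b1 b2 S rs" "arm b2 b1 S ss"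
    using linked_arm[OF linked(1), of S] linked_arm[OF linked(2), of S] nb by metis
  have "a \<notin> set rs \<union> set ss" "p \<notin> set rs \<union> set ss"
    using arms tri pb sym unfolding arm_def by blast+
  then show False by (rule no_twin_arms[OF tw arms])
qed

lemma fewer_attachments:
  assumes tri: "E a b1" "E a b2" "E b1 b2" and h: "hole a b1 xs" and b2: "b2 \<notin> set xs"
    and hd: "\<not> E b2 (hd xs)" and mark: "x \<in> set xs" "E b2 x" "x \<noteq> last xs"
    and linked: "linked b2 b1 (hd xs)" "linked b1 b2 (hd xs)"
  shows "\<exists>ys. hole a b1 ys \<and> b2 \<notin> set ys \<and> \<not> E b2 (hd ys) \<and> (\<exists>y\<in>set ys. E b2 y)
    \<and> linked b2 b1 (hd ys) \<and> linked b1 b2 (hd ys)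
    \<and> {y \<in> set ys. E b2 y} \<subset> {x \<in> set xs. E b2 x}"
proof -
  define n where "n = length xs - 1"
  have n: "length xs = Suc n" "1 \<le> n" using hole_length[OF h] by (auto simp: n_def)
  have hd0: "hd xs = xs ! 0" "last xs = xs ! n"
    using n hd_conv_nth[of xs] last_conv_nth[of xs] by force+
  obtain k0 where k0: "k0 < Suc n" "x = xs ! k0" using mark(1) n by (auto simp: in_set_conv_nth)
  then have "k0 < n" using mark(3) hd0 by (cases "k0 = n") auto
  define i where "i = (LEAST k. E b2 (xs ! k))"
  have m0: "E b2 (xs ! k0)" using mark(2) k0(2) by simp
  then have "i \<le> k0" unfolding i_def by (rule Least_le)
  then have i_n: "i < n" using \<open>k0 < n\<close> by simp
  have i1: "E b2 (xs ! i)" unfolding i_def using m0 by (rule LeastI)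
  have i0: "1 \<le> i" using i1 hd hd0 by (cases i) auto
  have first: "\<not> E b2 (xs ! k)" if "k < i" for k using that not_less_Least unfolding i_def by blast
  have adj: "E (xs ! k) (xs ! l) \<longleftrightarrow> k = Suc l \<or> l = Suc k" "xs ! k = xs ! l \<longleftrightarrow> k = l"
    if "k \<le> n" "l \<le> n" for k l
    using hole_nth[OF h] hole_nth_eq[OF h] that n by auto
  have right: "E b1 (xs ! k) \<longleftrightarrow> k = n" if "k \<le> n" for k using hole_right[OF h] that n by simp
  obtain A y where A: "conn A" "hd xs \<in> A" "\<And>y. y \<in> A \<Longrightarrow> y \<noteq> b2 \<and> \<not> E b2 y" and y: "y \<in> A" "E b1 y"
    using linked(1) unfolding linked_def by blast
  obtain A' where A': "conn A'" "hd xs \<in> A'" "\<And>y. y \<in> A' \<Longrightarrow> y \<noteq> b1 \<and> \<not> E b1 y" "\<exists>y\<in>A'. E b2 y"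
    using linked(2) unfolding linked_def by blast
  have "y \<noteq> hd xs" using y(2) right[of 0] hd0 n by auto
  then obtain w where w: "w \<in> A" "E w (hd xs)" using conn_neighbour[OF A(1,2) y(1)] by metis
  \<comment> \<open>Position \<open>i\<close> belongs to neither side. With \<open>b1\<close> in
    \<open>?Y\<close>, only the first vertex of a shortest path can see \<open>b1\<close> or the far
    side.\<close>
  let ?X = "{xs ! k | k. k < i}" and ?Y = "insert b1 {xs ! k | k. i < k \<and> k \<le> n}"
  have X: "hd xs \<in> ?X" using hd0 i0 by auto
  obtain rs where rs: "ipath rs" "set rs \<subseteq> A"
    and rY: "\<And>v. v \<in> set rs \<Longrightarrow> (\<exists>y\<in>?Y. E y v) \<longleftrightarrow> v = hd rs"
    and rX: "\<And>v. v \<in> set rs \<Longrightarrow> (\<exists>x\<in>?X. E v x) \<longleftrightarrow> v = last rs"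
    and dis: "(\<And>y x. y \<in> ?Y \<Longrightarrow> x \<in> ?X \<Longrightarrow> \<not> E y x) \<Longrightarrow> set rs \<inter> (?X \<union> ?Y) = {}"
  proof (rule shortest_path[OF A(1) y(1) insertI1 y(2) w(1) X w(2)])
  qed (use that in blast)
  have d: "set rs \<inter> (?X \<union> ?Y) = {}"
  proof (rule dis)
    fix y x assume y: "y \<in> ?Y" and "x \<in> ?X"
    then obtain k where k: "k < i" "x = xs ! k" by blast
    show "\<not> E y x"
      using y
    proof
      assume "y = b1"
      then show ?thesis using k right[of k] i_n by simp
    next
      assume "y \<in> {xs ! k | k. i < k \<and> k \<le> n}"
      then obtain l where "i < l" "l \<le> n" "y = xs ! l" by blast
      then show ?thesis using adj(1)[of l k] k by auto
    qed
  qed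
  have new: "y \<notin> set xs \<and> y \<noteq> b1 \<and> y \<noteq> b2 \<and> \<not> E b2 y" if y: "y \<in> set rs" for y
  proof -
    have "xs ! k \<notin> set rs" if "k \<le> n" for k
    proof (cases "k = i")
      case True
      then show ?thesis using i1 A(3) rs(2) by blast
    next
      case False
      then have "xs ! k \<in> ?X \<union> ?Y" using that by (cases "k < i") auto
      then show ?thesis using d by blast
    qed
    then have "y \<notin> set xs" using y n unfolding in_set_conv_nth[of _ xs] less_Suc_eq_le n(1) by blast
    then show ?thesis using y d A(3) rs(2) by blast
  qed
  have rhd: "(E y b1 \<or> (\<exists>k. i < k \<and> k \<le> n \<and> E y (xs ! k))) \<longleftrightarrow> y = hd rs" if "y \<in> set rs" for y
    using rY[OF that] sym_iff[of y] by auto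
  have rlast: "(\<exists>k<i. E y (xs ! k)) \<longleftrightarrow> y = last rs" if "y \<in> set rs" for y
    using rX[OF that] by auto
  obtain ys where ys: "hole a b1 ys" "b2 \<notin> set ys" "\<exists>y\<in>set ys. E b2 y"
    "{y \<in> set ys. E b2 y} \<subseteq> {xs ! k | k. i < k \<and> k \<le> n}"
    "hd ys = hd xs \<or> (\<exists>j<length rs. hd ys = rs ! j \<and> (\<forall>k<length rs. j \<le> k \<longrightarrow> \<not> E b1 (rs ! k)))"
    using detour[OF tri h n(1) b2 i1 i0 i_n first rs(1) new rhd rlast] by blast
  have lk: "\<not> E b2 (hd ys) \<and> linked b2 b1 (hd ys) \<and> linked b1 b2 (hd ys)"
    using ys(5)
  proof
    assume "hd ys = hd xs"
    then show ?thesis using hd linked by simp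
  next
    assume "\<exists>j<length rs. hd ys = rs ! j \<and> (\<forall>k<length rs. j \<le> k \<longrightarrow> \<not> E b1 (rs ! k))"
    then obtain j where j: "j < length rs" "hd ys = rs ! j" "\<And>k. k < length rs \<Longrightarrow> j \<le> k \<Longrightarrow> \<not> E b1 (rs ! k)"
      by blast
    have jA: "rs ! j \<in> A" "rs ! j \<in> set rs" using j(1) rs(2) by auto
    have "linked b2 b1 (rs ! j)" unfolding linked_def using A jA(1) y by blast
    \<comment> \<open>The new connected set follows the rest of \<open>rs\<close> to the near side
      of the hole, returns to the old first vertex and joins the old set there; none of this sees
      \<open>b1\<close>. For the other link the old set serves unchanged, as it contains
      \<open>rs\<close>.\<close>
    moreover have "linked b1 b2 (rs ! j)"
    proof -
      have s: "j \<le> length rs - 1" "length rs - 1 < length rs" using j(1) by auto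
      have t: "0 \<le> i - 1" "i - 1 < length xs" using i_n n by auto
      let ?R = "set (seg rs j (length rs - 1))" and ?S = "set (seg xs 0 (i - 1))"
      have Sin: "x \<in> ?S \<longleftrightarrow> (\<exists>k<i. x = xs ! k)" for x
      proof -
        have "k \<le> i - 1 \<longleftrightarrow> k < i" for k using i0 by auto
        then show ?thesis using in_seg[OF t, of x] by simp
      qed
      have Rin: "x \<in> ?R \<Longrightarrow> \<exists>k<length rs. j \<le> k \<and> x = rs ! k" for x
        using in_seg[OF s, of x] order_le_less_trans[OF _ s(2)] by blast
      have "rs \<noteq> []" using j(1) by auto
      then have lr: "last rs \<in> ?R" "last rs \<in> set rs"
        using in_seg[OF s, of "last rs"] s last_conv_nth[of rs] by auto
      obtain k where k: "k < i" "E (last rs) (xs ! k)" using rlast[OF lr(2)] by blast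
      have "conn (?R \<union> ?S)"
        using conn_Un[OF conn_ipath[OF ipath_seg[OF rs(1) s]] conn_ipath[OF ipath_seg[OF hole_ipath[OF h] t]], of "last rs" "xs ! k"]
          lr(1) k Sin by blast
      moreover have "hd xs \<in> ?R \<union> ?S" using Sin[of "xs ! 0"] hd0(1) i0 by (metis UnI2 Suc_le_eq One_nat_def)
      ultimately have "conn ((?R \<union> ?S) \<union> A')"
        using conn_Un[OF _ A'(1), of "?R \<union> ?S" "hd xs" "hd xs"] A'(2) by blast
      moreover have "rs ! j \<in> ?R" using in_seg[OF s] s by blast
      moreover have "v \<noteq> b1 \<and> \<not> E b1 v" if v: "v \<in> (?R \<union> ?S) \<union> A'" for v
      proof -
        consider "v \<in> ?R" | "v \<in> ?S" | "v \<in> A'" using v by blast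
        then show ?thesis
        proof cases
          case 1
          then obtain k where "k < length rs" "j \<le> k" "v = rs ! k" using Rin by blast
          then show ?thesis using j(3)[of k] new[of v] by auto
        next
          case 2
          then obtain k where "k < i" "v = xs ! k" using Sin by blast
          then show ?thesis using right[of k] hole_nth_neq(2)[OF h, of k] i_n n by auto
        qed (use A'(3) in blast)
      qed
      ultimately show ?thesis unfolding linked_def using A'(4) by blast
    qed
    ultimately show ?thesis using j(2) new[OF jA(2)] by simp
  qed
  have "xs ! i \<in> {x \<in> set xs. E b2 x}" using i1 i_n n by simp
  moreover have "xs ! i \<notin> {xs ! k | k. i < k \<and> k \<le> n}" using adj(2)[of i] i_n by auto
  moreover have "{xs ! k | k. i < k \<and> k \<le> n} \<subseteq> set xs" using n by auto
  ultimately have "{y \<in> set ys. E b2 y} \<subset> {x \<in> set xs. E b2 x}" using ys(4) by blast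
  then show ?thesis using ys(1-3) lk by blast
qed

lemma no_attached_hole:
  assumes "E a b1" "E a b2" "E b1 b2" and "hole a b1 xs" "b2 \<notin> set xs" "\<not> E b2 (hd xs)"
    and "x \<in> set xs" "E b2 x" and "linked b2 b1 (hd xs)" "linked b1 b2 (hd xs)"
  shows False
  using assms(4-)
proof (induction "card {x \<in> set xs. E b2 x}" arbitrary: xs x rule: less_induct)
  case less
  show False
  proof (cases "\<exists>x\<in>set xs. E b2 x \<and> x \<noteq> last xs")
    case True
    then obtain x' where "x' \<in> set xs" "E b2 x'" "x' \<noteq> last xs" by blast
    from fewer_attachments[OF assms(1-3) less.prems(1-3) this less.prems(6,7)]
    obtain ys y where ys: "hole a b1 ys" "b2 \<notin> set ys" "\<not> E b2 (hd ys)" "y \<in> set ys" "E b2 y"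
      "linked b2 b1 (hd ys)" "linked b1 b2 (hd ys)"
      and lt: "{y \<in> set ys. E b2 y} \<subset> {x \<in> set xs. E b2 x}"
      by blast
    have "card {y \<in> set ys. E b2 y} < card {x \<in> set xs. E b2 x}"
      by (rule psubset_card_mono[OF _ lt]) simp
    then show False using less.hyps ys by blast
  next
    case False
    then have "x = last xs" using less.prems by blast
    then have "E b2 (last xs)" using less.prems by simp
    then show False
      using attached_only_at_end[OF assms(1-3) less.prems(1,2) _ less.prems(6,7)] False by blast
  qed
qed

text \<open>Shortest paths in \<open>F\<close> from \<open>c\<close> to \<open>b1\<close> and from
  \<open>c\<close> to \<open>b2\<close> give two holes through \<open>a\<close>. If
  \<open>b2\<close> sees the first path or \<open>b1\<close> the second,
  \<open>no_attached_hole\<close> applies. If neither happens, the second path links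
  \<open>b2\<close> to the first hole at \<open>c\<close>, contrary to
  \<open>no_link\<close>.\<close>

lemma paw_separation:
  assumes tri: "E a b1" "E a b2" "E b1 b2" and c: "E a c" "\<not> E b1 c" "\<not> E b2 c"
    and F: "conn F" "\<And>y. y \<in> F \<Longrightarrow> y \<noteq> a \<and> \<not> E a y"
    and att: "w \<in> F" "E c w" "w1 \<in> F" "E b1 w1" "w2 \<in> F" "E b2 w2"
    and linked: "linked b2 b1 c" "linked b1 b2 c"
  shows False
proof -
  have nF: "c \<notin> F" "b1 \<notin> F" "b2 \<notin> F" using F(2) c(1) tri by blast+
  have d: "c \<noteq> a" "c \<noteq> b1" "c \<noteq> b2" "a \<noteq> b1" "a \<noteq> b2"
    using c tri sym[OF tri(3)] irrefl by auto
  have ext: "hole a b (c # P)" "hd (c # P) = c"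
    if P: "ipath P" "set P \<subseteq> F" "\<And>v. v \<in> set P \<Longrightarrow> E c v \<longleftrightarrow> v = hd P"
      "\<And>v. v \<in> set P \<Longrightarrow> E b v \<longleftrightarrow> v = last P" and b: "E a b" "\<not> E b c" "c \<noteq> b" for P b
  proof -
    have ne: "P \<noteq> []" using P(1) ipath_not_Nil by blast
    have "ipath (c # P)" using P nF ne by (auto simp: ipath_Cons)
    moreover have "v \<noteq> a \<and> \<not> E a v \<and> v \<noteq> c \<and> v \<noteq> b" if "v \<in> set P" for v
      using F(2) nF P(2) b(1) that by blast
    ultimately show "hole a b (c # P)"
      unfolding hole_def using P(4) ne b c(1) d(1) by (cases P) auto
  qed simp
  obtain P where P: "ipath P" "set P \<subseteq> F" "\<And>v. v \<in> set P \<Longrightarrow> E c v \<longleftrightarrow> v = hd P"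
    "\<And>v. v \<in> set P \<Longrightarrow> E b1 v \<longleftrightarrow> v = last P"
  proof (rule shortest_path_between[OF F(1) att(1-4)])
  qed (use that in blast)
  obtain Q where Q: "ipath Q" "set Q \<subseteq> F" "\<And>v. v \<in> set Q \<Longrightarrow> E c v \<longleftrightarrow> v = hd Q"
    "\<And>v. v \<in> set Q \<Longrightarrow> E b2 v \<longleftrightarrow> v = last Q"
  proof (rule shortest_path_between[OF F(1) att(1,2,5,6)])
  qed (use that in blast)
  have hP: "hole a b1 (c # P)" by (rule ext[OF P tri(1) c(2) d(2)])
  have hQ: "hole a b2 (c # Q)" by (rule ext[OF Q tri(2) c(3) d(3)])
  have nP: "b2 \<notin> set (c # P)" "b1 \<notin> set (c # Q)" using P(2) Q(2) nF d by auto
  have Qne: "Q \<noteq> []" using Q(1) ipath_not_Nil by blast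
  show False
  proof (cases "\<exists>x\<in>set P. E b2 x")
    case True
    then obtain x where "x \<in> set (c # P)" "E b2 x" by auto
    then show False using no_attached_hole[OF tri hP nP(1)] c(3) linked by simp
  next
    case noP: False
    show False
    proof (cases "\<exists>x\<in>set Q. E b1 x")
      case True
      then obtain x where "x \<in> set (c # Q)" "E b1 x" by auto
      then show False
        using no_attached_hole[OF tri(2,1) sym[OF tri(3)] hQ nP(2)] c(2) linked by simp
    next
      case noQ: False
      show False
      proof (rule no_link[OF hP nP(1) sym[OF tri(2)] sym[OF tri(3)] _ conn_ipath[OF Q(1)]])
        show "\<not> E b2 x" if "x \<in> set (c # P)" for x using that noP c(3) by auto
        show "b2 \<notin> set Q" using Q(2) nF by blast
        show "last Q \<in> set Q" "hd Q \<in> set Q" using Qne by auto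
        then show "E b2 (last Q)" "E (hd Q) c" using Q(3,4) sym by blast+
        show "c \<in> set (c # P)" by simp
        show "v \<noteq> a \<and> \<not> E a v" "v \<noteq> b1 \<and> \<not> E b1 v" if "v \<in> set Q" for v
          using that Q(2) F(2) nF noQ by blast+
      qed
    qed
  qed
qed

end

section \<open>From the graph on \<open>V\<close> to the whole type, and from breaking to
  links\<close>

lemma (in simple_graph) induced_path_in:
  assumes V: "\<And>x y. E x y \<Longrightarrow> x \<in> V" and P: "ipath P" "hd P \<noteq> last P"
  shows "induced_path V E P"
proof -
  have ne: "P \<noteq> []" using P(1) ipath_not_Nil by blast
  have "x \<in> V" if x: "x \<in> set P" for x
  proof -
    obtain i where i: "i < length P" "x = P ! i" using x by (auto simp: in_set_conv_nth)
    \<comment> \<open>Different ends rule out a single vertex, which is an induced path over the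
      whole type even if it lies outside \<open>V\<close>.\<close>
    have "length P \<noteq> 1" using P(2) by (auto simp: length_Suc_conv)
    then have "Suc i < length P \<or> (i > 0 \<and> i - 1 < length P)" using i by (cases "length P"; cases i) auto
    then show ?thesis
      using i ipath_nth[OF P(1), of i "Suc i"] ipath_nth[OF P(1), of i "i - 1"] V by fastforce
  qed
  then show ?thesis using P(1) by (auto simp: induced_path_def)
qed

lemma (in simple_graph) prism_free_graphI:
  assumes V: "\<And>x y. E x y \<Longrightarrow> x \<in> V"
    and "perfect V E" "\<not> has_induced_C4 V E" "\<not> has_induced_prism V E"
  shows "prism_free_graph E"
proof
  show "even (length xs)" if "hole u v xs" for u v xs
    using perfect_even_hole[OF assms(2) V that] .
  show "\<not> has_induced_C4 UNIV E"
  proof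
    assume "has_induced_C4 UNIV E"
    then obtain v1 v2 v3 v4 where v: "distinct [v1, v2, v3, v4]" "E v1 v2" "E v2 v3" "E v3 v4" "E v4 v1"
      "\<not> E v1 v3" "\<not> E v2 v4"
      unfolding has_induced_C4_def by blast
    show False
      using assms(3) v V[OF v(2)] V[OF v(3)] V[OF v(4)] V[OF v(5)] unfolding has_induced_C4_def by blast
  qed
  show "\<not> has_induced_prism UNIV E"
  proof
    assume "has_induced_prism UNIV E"
    then obtain P Q R where p: "ipath P" "ipath Q" "ipath R"
      "{hd P, hd Q, hd R} \<inter> {last P, last Q, last R} = {}"
      "E (hd P) (hd Q) \<and> E (hd Q) (hd R) \<and> E (hd P) (hd R)
        \<and> E (last P) (last Q) \<and> E (last Q) (last R) \<and> E (last P) (last R)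
        \<and> prism_paths_ok E P Q \<and> prism_paths_ok E P R \<and> prism_paths_ok E Q R"
      unfolding has_induced_prism_def by blast
    have "hd P \<noteq> last P" "hd Q \<noteq> last Q" "hd R \<noteq> last R" using p(4) by auto
    then have "induced_path V E P" "induced_path V E Q" "induced_path V E R"
      using induced_path_in[OF V p(1)] induced_path_in[OF V p(2)] induced_path_in[OF V p(3)] by simp_all
    then show False using assms(4) p(4,5) unfolding has_induced_prism_def by blast
  qed
qed

lemma not_breaks_component:
  assumes "\<not> breaks V E x Y" "x \<in> V" "Y \<subseteq> V" "x \<notin> Y"
  obtains D where "component E (V - closed_nbhd V E {x}) D" "Y \<subseteq> closed_nbhd V E D"
  using assms unfolding breaks_def by blast

theorem theorem5p6:
  fixes V :: "'a set" and E :: "'a \<Rightarrow> 'a \<Rightarrow> bool" and a c b1 b2 :: 'a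
  assumes "graph V E"
    and "\<not> has_induced_C4 V E" and "\<not> has_induced_prism V E"
    and "perfect V E"
    and "a \<in> V" "c \<in> V" "b1 \<in> V" "b2 \<in> V" "distinct [a, c, b1, b2]"
    and "E a b1" "E a b2" "E b1 b2" "E a c" "\<not> E c b1" "\<not> E c b2"
  shows "breaks V E a {c, b1, b2} \<or> breaks V E b1 {c, b2} \<or> breaks V E b2 {c, b1}"
proof (rule ccontr)
  assume "\<not> ?thesis"
  then have nb: "\<not> breaks V E a {c, b1, b2}" "\<not> breaks V E b1 {c, b2}" "\<not> breaks V E b2 {c, b1}"
    by blast+
  have inV: "x \<in> V" and sym: "E y x" if "E x y" for x y
    using assms(1) that unfolding graph_def by blast+
  interpret simple_graph E
    using assms(1) by unfold_locales (auto simp: graph_def)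
  interpret prism_free_graph E
    using prism_free_graphI[OF inV assms(4,2,3)] .
  have d: "a \<noteq> c" "a \<noteq> b1" "a \<noteq> b2" "c \<noteq> b1" "c \<noteq> b2" "b1 \<noteq> b2" using assms(9) by auto
  have comp: "conn D" "\<And>y. y \<in> D \<Longrightarrow> y \<noteq> x \<and> \<not> E x y"
    if D: "component E (V - closed_nbhd V E {x}) D" for D x
  proof -
    show "conn D" using D unfolding component_def conn_def by blast
    show "y \<noteq> x \<and> \<not> E x y" if "y \<in> D" for y
    proof -
      have "y \<in> V" "y \<notin> closed_nbhd V E {x}" using D that unfolding component_def by blast+
      then show ?thesis using sym[of x y] by (auto simp: closed_nbhd_def)
    qed
  qed
  have lk: "linked b b' c"
    if nb: "\<not> breaks V E b {c, b'}" and b: "b \<in> V" "b' \<in> V" "c \<noteq> b" "b \<noteq> b'" "E b b'" "\<not> E c b" for b b'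
  proof -
    obtain D where D: "component E (V - closed_nbhd V E {b}) D" "{c, b'} \<subseteq> closed_nbhd V E D"
      by (rule not_breaks_component[OF nb b(1)]) (use b assms(6) in auto)
    \<comment> \<open>\<open>c\<close> survives the removal of \<open>N[b]\<close>, so by maximality
      of the component it lies in \<open>D\<close> itself and not merely next to it.\<close>
    have "c \<in> V - closed_nbhd V E {b}" using assms(6) b by (auto simp: closed_nbhd_def)
    moreover have "c \<in> D \<or> (\<exists>x\<in>D. E c x)" using D(2) by (auto simp: closed_nbhd_def)
    ultimately have "c \<in> D" using D(1) sym unfolding component_def by blast
    moreover have "\<exists>y\<in>D. E b' y" using D(2) comp(2)[OF D(1)] b(5) unfolding closed_nbhd_def by blast
    ultimately show ?thesis unfolding linked_def using comp[OF D(1)] by blast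
  qed
  have links: "linked b1 b2 c" "linked b2 b1 c"
    using lk[OF nb(2) assms(7,8) d(4,6) assms(12,14)]
      lk[OF nb(3) assms(8,7) d(5) _ sym[OF assms(12)] assms(15)] d(6) by auto
  obtain F where F: "component E (V - closed_nbhd V E {a}) F" "{c, b1, b2} \<subseteq> closed_nbhd V E F"
    by (rule not_breaks_component[OF nb(1) assms(5)]) (use d assms in auto)
  \<comment> \<open>All three vertices are neighbours of \<open>a\<close> and hence outside
    \<open>F\<close>, so membership in \<open>N[F]\<close> means a neighbour in
    \<open>F\<close>.\<close>
  have attached: "\<exists>y\<in>F. E x y" if x: "x \<in> {c, b1, b2}" for x
  proof -
    have "E a x" using x assms(10,11,13) by blast
    then have "x \<notin> F" using comp(2)[OF F(1)] by blast
    then show ?thesis using x F(2) by (auto simp: closed_nbhd_def)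
  qed
  obtain w w1 w2 where "w \<in> F" "E c w" "w1 \<in> F" "E b1 w1" "w2 \<in> F" "E b2 w2"
    using attached[of c] attached[of b1] attached[of b2] by blast
  moreover have "\<not> E b1 c" "\<not> E b2 c" using assms(14,15) sym by blast+
  ultimately show False
    by (intro paw_separation[OF assms(10-13) _ _ comp[OF F(1)] _ _ _ _ _ _ links(2,1)])
qed

end
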